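(* Let $m\ge 1$ and $n\ge 0$ be integers and let $$\bar{s}(m,n)=\begin{cases}(m+1)\lfloor n/2\rfloor+1 & \text{if } n \text{ is even},\\ (m+1)\lfloor n/2\rfloor+3 & \text{otherwise.}\end{cases}$$ Then $\sigma_s(X_{m,n})$ has the expected dimension for any $s\geq\bar{s}(m,n)$.
   Context: We work over $\mathbb{C}$. For an irreducible non-singular variety $X\subset \mathbb{P}^N$ of dimension $d$ and $s\ge 1$, the $s$-th secant variety $\sigma_s(X)$ is the Zariski closure of the union of the linear spans of all $s$-tuples of points of $X$. Its expected dimension is $\min\{N, s(d+1)-1\}$; we say $\sigma_s(X)$ has the expected dimension if $\dim\sigma_s(X)$ equals this number. $X_{m,n}$ denotes the Segre-Veronese variety $\mathbb{P}^m\times\mathbb{P}^n$ embedded in $\mathbb{P}^{(m+1)\binom{n+2}{2}-1}$ by the morphism given by $\mathcal{O}(1,2)$; it has dimension $m+n$. *)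

theory Defs
  imports
    "HOL-Analysis.Abstract_Topology"
    "HOL-Library.Poly_Mapping"
    "HOL-Library.Function_Algebras"
    "HOL-Library.Extended_Nat"
begin

section \<open>Projective space over the complex numbers\<close>

text \<open>
  Homogeneous coordinates are indexed by a set \<open>I\<close>: a vector of \<open>\<complex>\<^bsup>I\<^esup>\<close> is a function vanishing
  outside \<open>I\<close>, and a point of \<open>P(\<complex>\<^bsup>I\<^esup>)\<close> is a line through the origin.
  With \<open>card I = N + 1\<close> this is \<open>P\<^sup>N\<close>.
\<close>

global_interpretation cfun: vector_space "\<lambda>(c::complex) (v::'i \<Rightarrow> complex) i. c * v i"
  defines cspan = cfun.span
  by unfold_locales (auto simp: fun_eq_iff algebra_simps)

definition coord_space :: "'i set \<Rightarrow> ('i \<Rightarrow> complex) set" where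
  "coord_space I = {v. \<forall>i. i \<notin> I \<longrightarrow> v i = 0}"

definition proj_point :: "('i \<Rightarrow> complex) \<Rightarrow> ('i \<Rightarrow> complex) set" where
  "proj_point v = cspan {v}"

definition proj_space :: "'i set \<Rightarrow> ('i \<Rightarrow> complex) set set" where
  "proj_space I = proj_point ` (coord_space I - {0})"

text \<open>The points of projective space lying on the linear span of a set \<open>A\<close> of points.\<close>

definition proj_span :: "'i set \<Rightarrow> ('i \<Rightarrow> complex) set set \<Rightarrow> ('i \<Rightarrow> complex) set set" where
  "proj_span I A = {q \<in> proj_space I. q \<subseteq> cspan (\<Union>A)}"


section \<open>Homogeneous polynomials and the Zariski topology\<close>

text \<open>A polynomial is a finitely supported map from exponent vectors to coefficients.\<close>

type_synonym 'i cpoly = "('i \<Rightarrow>\<^sub>0 nat) \<Rightarrow>\<^sub>0 complex"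

definition eval_monom :: "('i \<Rightarrow>\<^sub>0 nat) \<Rightarrow> ('i \<Rightarrow> complex) \<Rightarrow> complex" where
  "eval_monom a v = (\<Prod>i\<in>Poly_Mapping.keys a. v i ^ Poly_Mapping.lookup a i)"

definition eval_poly :: "'i cpoly \<Rightarrow> ('i \<Rightarrow> complex) \<Rightarrow> complex" where
  "eval_poly p v = (\<Sum>a\<in>Poly_Mapping.keys p. Poly_Mapping.lookup p a * eval_monom a v)"

definition total_degree :: "('i \<Rightarrow>\<^sub>0 nat) \<Rightarrow> nat" where
  "total_degree a = (\<Sum>i\<in>Poly_Mapping.keys a. Poly_Mapping.lookup a i)"

definition homogeneous_polys :: "'i set \<Rightarrow> 'i cpoly set" where
  "homogeneous_polys I =
     {p. \<exists>d. \<forall>a\<in>Poly_Mapping.keys p. Poly_Mapping.keys a \<subseteq> I \<and> total_degree a = d}"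

definition zero_locus :: "'i set \<Rightarrow> 'i cpoly set \<Rightarrow> ('i \<Rightarrow> complex) set set" where
  "zero_locus I F = {q \<in> proj_space I. \<forall>p\<in>F. \<forall>v\<in>q. eval_poly p v = 0}"

definition zariski :: "'i set \<Rightarrow> ('i \<Rightarrow> complex) set topology" where
  "zariski I = topology (\<lambda>U. \<exists>F \<subseteq> homogeneous_polys I. U = proj_space I - zero_locus I F)"

lemma eval_monom_superset:
  assumes "finite S" "Poly_Mapping.keys a \<subseteq> S"
  shows "eval_monom a v = (\<Prod>i\<in>S. v i ^ Poly_Mapping.lookup a i)"
  unfolding eval_monom_def using assms
  by (intro prod.mono_neutral_left) (auto simp: in_keys_iff)

lemma eval_monom_add: "eval_monom (a + b) v = eval_monom a v * eval_monom b v"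
proof -
  let ?S = "Poly_Mapping.keys a \<union> Poly_Mapping.keys b"
  have "Poly_Mapping.keys (a + b) \<subseteq> ?S"
    by (rule Poly_Mapping.keys_add)
  then show ?thesis
    by (simp add: eval_monom_superset[of ?S] lookup_add power_add prod.distrib)
qed

lemma eval_poly_superset:
  assumes "finite S" "Poly_Mapping.keys p \<subseteq> S"
  shows "eval_poly p v = (\<Sum>a\<in>S. Poly_Mapping.lookup p a * eval_monom a v)"
  unfolding eval_poly_def using assms
  by (intro sum.mono_neutral_left) (auto simp: in_keys_iff)

lemma eval_poly_zero [simp]: "eval_poly 0 v = 0"
  by (simp add: eval_poly_def)

lemma eval_poly_add: "eval_poly (p + q) v = eval_poly p v + eval_poly q v"
proof -
  let ?S = "Poly_Mapping.keys p \<union> Poly_Mapping.keys q"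
  have "Poly_Mapping.keys (p + q) \<subseteq> ?S"
    by (rule Poly_Mapping.keys_add)
  then show ?thesis
    by (simp add: eval_poly_superset[of ?S] lookup_add distrib_right sum.distrib)
qed

lemma eval_poly_single: "eval_poly (Poly_Mapping.single a c) v = c * eval_monom a v"
  by (cases "c = 0") (auto simp: eval_poly_def)

lemma eval_poly_mult: "eval_poly (p * q) v = eval_poly p v * eval_poly q v"
proof (induction p rule: update_induct)
  case const
  then show ?case by simp
next
  case (update f a c)
  have upd: "Poly_Mapping.update a c f = f + Poly_Mapping.single a c"
    using update.hyps
    by (intro poly_mapping_eqI) (auto simp: lookup_update lookup_add lookup_single when_def in_keys_iff)
  have "eval_poly (Poly_Mapping.single a c * q) v = c * eval_monom a v * eval_poly q v" for q
  proof (induction q rule: update_induct)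
    case const
    then show ?case by simp
  next
    case (update g b e)
    have "Poly_Mapping.update b e g = g + Poly_Mapping.single b e"
      using update.hyps
      by (intro poly_mapping_eqI) (auto simp: lookup_update lookup_add lookup_single when_def in_keys_iff)
    with update.IH show ?case
      by (simp add: distrib_left eval_poly_add mult_single eval_poly_single eval_monom_add)
  qed
  then show ?case
    by (simp add: upd distrib_right eval_poly_add update.IH eval_poly_single)
qed

lemma homogeneous_eval_scale:
  assumes "p \<in> homogeneous_polys I"
  shows "\<exists>d. \<forall>c v. eval_poly p (\<lambda>i. c * v i) = c ^ d * eval_poly p v"
proof -
  obtain d where d: "\<And>a. a \<in> Poly_Mapping.keys p \<Longrightarrow> total_degree a = d"
    using assms by (auto simp: homogeneous_polys_def)
  have "eval_monom a (\<lambda>i. c * v i) = c ^ total_degree a * eval_monom a v"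
    for a :: "'a \<Rightarrow>\<^sub>0 nat" and c v
    by (simp add: eval_monom_def total_degree_def power_mult_distrib prod.distrib power_sum)
  then have "eval_poly p (\<lambda>i. c * v i) = c ^ d * eval_poly p v" for c v
    unfolding eval_poly_def sum_distrib_left by (intro sum.cong) (auto simp: d)
  then show ?thesis by blast
qed

lemma homogeneous_polys_mult:
  assumes "p \<in> homogeneous_polys I" "q \<in> homogeneous_polys I"
  shows "p * q \<in> homogeneous_polys I"
proof -
  obtain d where d: "\<And>a. a \<in> Poly_Mapping.keys p \<Longrightarrow> Poly_Mapping.keys a \<subseteq> I \<and> total_degree a = d"
    using assms by (auto simp: homogeneous_polys_def)
  obtain e where e: "\<And>a. a \<in> Poly_Mapping.keys q \<Longrightarrow> Poly_Mapping.keys a \<subseteq> I \<and> total_degree a = e"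
    using assms by (auto simp: homogeneous_polys_def)
  have deg: "total_degree (a + b) = total_degree a + total_degree b" for a b :: "'a \<Rightarrow>\<^sub>0 nat"
    unfolding total_degree_def by (rule setsum_keys_plus_distrib) auto
  have "Poly_Mapping.keys c \<subseteq> I \<and> total_degree c = d + e" if c: "c \<in> Poly_Mapping.keys (p * q)" for c
  proof -
    obtain a b where ab: "c = a + b" "a \<in> Poly_Mapping.keys p" "b \<in> Poly_Mapping.keys q"
      using c keys_mult[of p q] by blast
    show ?thesis
      using d[OF ab(2)] e[OF ab(3)] Poly_Mapping.keys_add[of a b] unfolding ab(1) deg by blast
  qed
  then show ?thesis by (auto simp: homogeneous_polys_def)
qed

lemma in_proj_point_iff: "w \<in> proj_point v \<longleftrightarrow> (\<exists>c. w = (\<lambda>i. c * v i))"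
  by (auto simp: proj_point_def cfun.span_singleton)

lemma vanishes_at_point_iff:
  assumes "p \<in> homogeneous_polys I"
  shows "(\<forall>w\<in>proj_point v. eval_poly p w = 0) \<longleftrightarrow> eval_poly p v = 0"
proof -
  obtain d where d: "\<And>c v. eval_poly p (\<lambda>i. c * v i) = c ^ d * eval_poly p v"
    using homogeneous_eval_scale[OF assms] by blast
  have "v \<in> proj_point v"
    unfolding in_proj_point_iff by (rule exI[of _ 1]) simp
  moreover have "eval_poly p w = 0" if "w \<in> proj_point v" "eval_poly p v = 0" for w
    using that unfolding in_proj_point_iff by (elim exE) (simp only: d mult_zero_right)
  ultimately show ?thesis by blast
qed

lemma zero_locus_Un: "zero_locus I (\<Union>\<F>) = proj_space I \<inter> (\<Inter>F\<in>\<F>. zero_locus I F)"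
  by (auto simp: zero_locus_def)

lemma zero_locus_mult:
  assumes "F \<subseteq> homogeneous_polys I" "G \<subseteq> homogeneous_polys I"
  shows "zero_locus I {p * q |p q. p \<in> F \<and> q \<in> G} = zero_locus I F \<union> zero_locus I G"
proof -
  have "proj_point v \<in> zero_locus I {p * q |p q. p \<in> F \<and> q \<in> G} \<longleftrightarrow>
        proj_point v \<in> zero_locus I F \<union> zero_locus I G" for v
  proof -
    have *: "proj_point v \<in> zero_locus I H \<longleftrightarrow>
             proj_point v \<in> proj_space I \<and> (\<forall>p\<in>H. eval_poly p v = 0)"
      if "H \<subseteq> homogeneous_polys I" for H
      using that vanishes_at_point_iff[of _ I v] by (auto simp: zero_locus_def)
    have "{p * q |p q. p \<in> F \<and> q \<in> G} \<subseteq> homogeneous_polys I"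
      using assms homogeneous_polys_mult by blast
    from *[OF this] *[OF assms(1)] *[OF assms(2)] have
      "proj_point v \<in> zero_locus I {p * q |p q. p \<in> F \<and> q \<in> G} \<longleftrightarrow>
         proj_point v \<in> proj_space I \<and> (\<forall>p\<in>F. \<forall>q\<in>G. eval_poly p v * eval_poly q v = 0)"
      "proj_point v \<in> zero_locus I F \<union> zero_locus I G \<longleftrightarrow>
         proj_point v \<in> proj_space I \<and>
         ((\<forall>p\<in>F. eval_poly p v = 0) \<or> (\<forall>q\<in>G. eval_poly q v = 0))"
      unfolding eval_poly_mult[symmetric] by blast+
    then show ?thesis
      unfolding mult_eq_0_iff by blast
  qed
  moreover have "zero_locus I H \<subseteq> range proj_point" for H
    by (auto simp: zero_locus_def proj_space_def)
  ultimately show ?thesis by blast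
qed

lemma istopology_zariski:
  "istopology (\<lambda>U. \<exists>F \<subseteq> homogeneous_polys I. U = proj_space I - zero_locus I F)"
  unfolding istopology_def
proof (intro conjI allI impI)
  fix S T
  assume "\<exists>F \<subseteq> homogeneous_polys I. S = proj_space I - zero_locus I F"
    and "\<exists>F \<subseteq> homogeneous_polys I. T = proj_space I - zero_locus I F"
  then obtain F G where F: "F \<subseteq> homogeneous_polys I" "S = proj_space I - zero_locus I F"
    and G: "G \<subseteq> homogeneous_polys I" "T = proj_space I - zero_locus I G"
    by blast
  have "S \<inter> T = proj_space I - zero_locus I {p * q |p q. p \<in> F \<and> q \<in> G}"
    using F G zero_locus_mult[of F I G] by blast
  moreover have "{p * q |p q. p \<in> F \<and> q \<in> G} \<subseteq> homogeneous_polys I"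
    using F G homogeneous_polys_mult by blast
  ultimately show "\<exists>F \<subseteq> homogeneous_polys I. S \<inter> T = proj_space I - zero_locus I F"
    by blast
next
  fix \<U>
  assume \<U>: "\<forall>U\<in>\<U>. \<exists>F \<subseteq> homogeneous_polys I. U = proj_space I - zero_locus I F"
  have "\<exists>f. \<forall>U\<in>\<U>. f U \<subseteq> homogeneous_polys I \<and> U = proj_space I - zero_locus I (f U)"
    by (rule bchoice) (rule \<U>)
  then obtain f where f: "\<And>U. U \<in> \<U> \<Longrightarrow> f U \<subseteq> homogeneous_polys I"
      "\<And>U. U \<in> \<U> \<Longrightarrow> U = proj_space I - zero_locus I (f U)"
    by blast
  have "\<Union>\<U> = (\<Union>U\<in>\<U>. proj_space I - zero_locus I (f U))"
    using SUP_cong[OF refl f(2), of \<U> "\<lambda>U. U"] by simp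
  also have "\<dots> = proj_space I - zero_locus I (\<Union>(f ` \<U>))"
    unfolding zero_locus_Un by blast
  finally have "\<Union>\<U> = proj_space I - zero_locus I (\<Union>(f ` \<U>))" .
  moreover have "\<Union>(f ` \<U>) \<subseteq> homogeneous_polys I"
    using f(1) by (rule UN_least)
  ultimately show "\<exists>F \<subseteq> homogeneous_polys I. \<Union>\<U> = proj_space I - zero_locus I F"
    by (intro exI[of _ "\<Union>(f ` \<U>)"] conjI)
qed

lemma openin_zariski:
  "openin (zariski I) U \<longleftrightarrow> (\<exists>F \<subseteq> homogeneous_polys I. U = proj_space I - zero_locus I F)"
  by (simp add: zariski_def topology_inverse'[OF istopology_zariski])

lemma topspace_zariski [simp]: "topspace (zariski I) = proj_space I"
proof
  show "topspace (zariski I) \<subseteq> proj_space I"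
    using openin_topspace[of "zariski I"] unfolding openin_zariski by blast
  have "(1 :: 'a cpoly) \<in> homogeneous_polys I"
    by (auto simp: homogeneous_polys_def total_degree_def)
  moreover have "zero_locus I {1 :: 'a cpoly} = {}"
  proof -
    have "v \<in> proj_point v" for v :: "'a \<Rightarrow> complex"
      unfolding in_proj_point_iff by (rule exI[of _ 1]) simp
    then show ?thesis
      by (auto simp: zero_locus_def proj_space_def eval_poly_def eval_monom_def)
  qed
  ultimately have "openin (zariski I) (proj_space I)"
    unfolding openin_zariski by (intro exI[of _ "{1}"]) auto
  then show "proj_space I \<subseteq> topspace (zariski I)"
    by (rule openin_subset)
qed

lemma closedin_zariski:
  "closedin (zariski I) Z \<longleftrightarrow> (\<exists>F \<subseteq> homogeneous_polys I. Z = zero_locus I F)"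
proof -
  have "zero_locus I F \<subseteq> proj_space I" for F
    by (auto simp: zero_locus_def)
  then show ?thesis
    unfolding closedin_def topspace_zariski openin_zariski by blast
qed


section \<open>Dimension\<close>

definition irreducible_space :: "'a topology \<Rightarrow> bool" where
  "irreducible_space X \<longleftrightarrow> topspace X \<noteq> {} \<and>
     (\<forall>A B. closedin X A \<and> closedin X B \<and> A \<union> B = topspace X \<longrightarrow> A = topspace X \<or> B = topspace X)"

text \<open>
  Krull dimension: the supremum of the lengths \<open>k\<close> of strictly increasing chains
  \<open>Z 0 \<subset> \<dots> \<subset> Z k\<close> of irreducible closed subsets.  (The empty space gets dimension 0.)
\<close>

definition krull_dim :: "'a topology \<Rightarrow> enat" where
  "krull_dim X = (SUP k \<in> {k. \<exists>Z :: nat \<Rightarrow> 'a set.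
      (\<forall>i\<le>k. closedin X (Z i) \<and> irreducible_space (subtopology X (Z i))) \<and>
      (\<forall>i<k. Z i \<subset> Z (Suc i))}. enat k)"

definition variety_dim :: "'i set \<Rightarrow> ('i \<Rightarrow> complex) set set \<Rightarrow> enat" where
  "variety_dim I X = krull_dim (subtopology (zariski I) X)"


section \<open>Secant varieties\<close>

definition secant_variety ::
  "'i set \<Rightarrow> ('i \<Rightarrow> complex) set set \<Rightarrow> nat \<Rightarrow> ('i \<Rightarrow> complex) set set" where
  "secant_variety I X s =
     zariski I closure_of (\<Union>p \<in> {..<s} \<rightarrow> X. proj_span I (p ` {..<s}))"

text \<open>The ambient projective space has dimension \<open>N = card I - 1\<close>.\<close>

definition expected_secant_dim :: "'i set \<Rightarrow> ('i \<Rightarrow> complex) set set \<Rightarrow> nat \<Rightarrow> enat" where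
  "expected_secant_dim I X s =
     min (enat (card I - 1)) (enat s * (variety_dim I X + 1) - 1)"

definition secant_has_expected_dim :: "'i set \<Rightarrow> ('i \<Rightarrow> complex) set set \<Rightarrow> nat \<Rightarrow> bool" where
  "secant_has_expected_dim I X s \<longleftrightarrow>
     variety_dim I (secant_variety I X s) = expected_secant_dim I X s"


section \<open>The Segre-Veronese variety\<close>

text \<open>
  The sections \<open>x\<^sub>i y\<^sub>j y\<^sub>k\<close> with \<open>i \<le> m\<close> and \<open>j \<le> k \<le> n\<close> form a basis of the global sections of
  \<open>O(1,2)\<close> on \<open>P\<^sup>m \<times> P\<^sup>n\<close>.
\<close>

definition sv_index :: "nat \<Rightarrow> nat \<Rightarrow> (nat \<times> nat \<times> nat) set" where
  "sv_index m n = {(i, j, k). i \<le> m \<and> j \<le> k \<and> k \<le> n}"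

definition sv_map :: "(nat \<Rightarrow> complex) \<Rightarrow> (nat \<Rightarrow> complex) \<Rightarrow> nat \<times> nat \<times> nat \<Rightarrow> complex" where
  "sv_map x y = (\<lambda>(i, j, k). if j \<le> k then x i * y j * y k else 0)"

definition segre_veronese :: "nat \<Rightarrow> nat \<Rightarrow> (nat \<times> nat \<times> nat \<Rightarrow> complex) set set" where
  "segre_veronese m n =
     {proj_point (sv_map x y) |x y. x \<in> coord_space {..m} - {0} \<and> y \<in> coord_space {..n} - {0}}"

lemma card_sv_index: "card (sv_index m n) = (m + 1) * ((n + 2) choose 2)"
proof -
  have "sv_index m n = {..m} \<times> (\<lambda>(k, j). (j, k)) ` (SIGMA k:{..n}. {..k})"
    by (force simp: sv_index_def image_def)
  moreover have "card ((\<lambda>(k, j). (j, k)) ` (SIGMA k:{..n}. {..k})) = (\<Sum>k\<le>n. Suc k)"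
    by (subst card_image) (auto simp: inj_on_def)
  moreover have "(\<Sum>k\<le>n. Suc k) = (n + 2) choose 2"
    by (induction n) (auto simp: numeral_2_eq_2)
  ultimately show ?thesis
    by (simp add: card_cartesian_product)
qed

lemma segre_veronese_subset: "segre_veronese m n \<subseteq> proj_space (sv_index m n)"
proof
  fix q assume "q \<in> segre_veronese m n"
  then obtain x y where q: "q = proj_point (sv_map x y)"
    and x: "x \<in> coord_space {..m}" "x \<noteq> 0" and y: "y \<in> coord_space {..n}" "y \<noteq> 0"
    by (auto simp: segre_veronese_def)
  obtain i j where "x i \<noteq> 0" "y j \<noteq> 0"
    using x(2) y(2) by (auto simp: fun_eq_iff)
  then have "sv_map x y (i, j, j) \<noteq> 0"
    by (simp add: sv_map_def)
  then have "sv_map x y \<noteq> 0" by (metis zero_fun_apply)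
  moreover have "sv_map x y \<in> coord_space (sv_index m n)"
    using x(1) y(1) by (auto simp: coord_space_def sv_index_def sv_map_def)
  ultimately show "q \<in> proj_space (sv_index m n)"
    by (auto simp: q proj_space_def)
qed

definition s_bar :: "nat \<Rightarrow> nat \<Rightarrow> nat" where
  "s_bar m n = (if even n then (m + 1) * (n div 2) + 1 else (m + 1) * (n div 2) + 3)"

end

theory Submission
  imports Defs "HOL-Computational_Algebra.Polynomial"
begin

text \<open>
  For \<open>s \<ge> s_bar m n\<close> one always has \<open>s (m + n + 1) \<ge> (m + 1) ((n + 2) choose 2)\<close>, so the expected
  dimension is that of the ambient space as soon as the Segre-Veronese variety has dimension at least
  \<open>m + n\<close>, and the claim is that the secant variety fills the ambient space.  Three things are needed.

  \<^item> The space \<open>P\<^sup>N\<close> has Krull dimension \<open>N\<close> (\<open>krull_dim_proj_space_ge\<close>, \<open>krull_dim_proj_space_le\<close>).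
    For the upper bound, a chain \<open>Z 0 \<subset> \<dots> \<subset> Z k\<close> of irreducible closed sets yields \<open>k + 1\<close> forms of one
    common degree \<open>d\<close> without nontrivial homogeneous algebraic relation on \<open>Z k\<close>: one form does
    not vanish identically on \<open>Z 0\<close>, and each further one vanishes on \<open>Z i\<close> but not on \<open>Z (i + 1)\<close>.
    Counting their monomials of degree \<open>k n\<close> inside the forms of degree \<open>k n d\<close> in \<open>N + 1\<close> variables, for \<open>n\<close>
    large, gives \<open>k \<le> N\<close>.

  \<^item> The Segre-Veronese variety has dimension at least \<open>m + n\<close>: it contains a chain of smaller
    Segre-Veronese varieties (\<open>variety_dim_segre_veronese_ge\<close>).

  \<^item> The secant variety is dense if the tangent spaces to the cone over the variety at finitely many
    points, at most \<open>s\<close>, span (the easy half of Terracini's lemma, \<open>secant_variety_eq_proj_space\<close>).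
    By duality this means: the only symmetric bilinear forms \<open>Q 0, \<dots>, Q m\<close> on \<open>\<complex>\<^bsup>n+1\<^esup>\<close> such that
    \<open>Q i y y = 0\<close> for all \<open>i\<close> and \<open>\<Sum>i. x\<^sub>i Q i y _ = 0\<close>, at each of the points \<open>(x, y)\<close>, are zero.

  Such points are explicit (\<open>ex_spanning_configuration\<close>).  For \<open>m = 1\<close> the points
  \<open>((1, j), e\<^sub>j)\<close>, \<open>j \<le> n\<close>, work.  For \<open>m \<ge> 2\<close>, split \<open>\<complex>\<^bsup>n+1\<^esup>\<close> into a base of dimension \<open>r \<le> 2\<close>
  and planes \<open>B\<^sub>p\<close>.  A few points with \<open>y\<close> in the base kill the \<open>Q i\<close> there.  Each plane
  contributes \<open>m + 1\<close> points, one for each \<open>z\<close> with \<open>z\<^bsup>m+1\<^esup> = 1\<close>: the vectors \<open>x\<close> form a basis of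
  \<open>\<complex>\<^bsup>m+1\<^esup>\<close>, and \<open>y = f\<^sub>1 + z f\<^sub>2 + z\<^sup>2 g\<^sub>0 + z\<^sup>3 g\<^sub>1\<close> runs through a rational curve, \<open>f\<^sub>1, f\<^sub>2\<close> being a basis
  of \<open>B\<^sub>p\<close> and \<open>g\<^sub>0, g\<^sub>1\<close> a basis of the base, padded by zeros if \<open>r < 2\<close>.
  The form \<open>\<Sum>i. x\<^sub>i Q i\<close> is then a quadric that passes through the
  \<open>m + 1\<close> points of the curve and is singular at one of them, which makes it vanish on the base
  and \<open>B\<^sub>p\<close> (\<open>quadric_singular_at_moment_point\<close>).  What remains are the restrictions of the \<open>Q i\<close> to
  \<open>B\<^sub>p \<times> B\<^sub>q\<close>, \<open>p \<noteq> q\<close>.  The points of \<open>B\<^sub>p\<close> express these through the operator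
  \<open>D\<^sub>p\<close> on \<open>\<complex>\<^bsup>m+1\<^esup>\<close> with eigenvectors \<open>x\<close> and eigenvalues \<open>z\<close>, and the conditions from \<open>p\<close> and \<open>q\<close>
  together force everything to vanish once the commutator of \<open>D\<^sub>p\<close> and \<open>D\<^sub>q\<close> is invertible.
  The \<open>x\<close> are chosen so that the \<open>D\<^sub>p\<close> are cyclic weighted shifts, for which this is visible
  (\<open>cyclic_commutator\<close>).
\<close>

section \<open>Polynomial functions\<close>

text \<open>
  The functions on \<open>\<complex>\<^bsup>I\<^esup>\<close> given by polynomials, not necessarily homogeneous, in finitely many
  coordinates.
\<close>

inductive_set polyfuns :: "(('i \<Rightarrow> complex) \<Rightarrow> complex) set" where
  const: "(\<lambda>v. c) \<in> polyfuns"
| coord: "(\<lambda>v. v i) \<in> polyfuns"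
| add: "f \<in> polyfuns \<Longrightarrow> g \<in> polyfuns \<Longrightarrow> (\<lambda>v. f v + g v) \<in> polyfuns"
| mult: "f \<in> polyfuns \<Longrightarrow> g \<in> polyfuns \<Longrightarrow> (\<lambda>v. f v * g v) \<in> polyfuns"

lemma polyfuns_sum:
  assumes "\<And>a. a \<in> A \<Longrightarrow> f a \<in> polyfuns"
  shows "(\<lambda>v. \<Sum>a\<in>A. f a v) \<in> polyfuns"
  using assms by (induction A rule: infinite_finite_induct) (auto intro: polyfuns.intros)

lemma polyfuns_prod:
  assumes "\<And>a. a \<in> A \<Longrightarrow> f a \<in> polyfuns"
  shows "(\<lambda>v. \<Prod>a\<in>A. f a v) \<in> polyfuns"
  using assms by (induction A rule: infinite_finite_induct) (auto intro: polyfuns.intros)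

lemma polyfuns_power: "f \<in> polyfuns \<Longrightarrow> (\<lambda>v. f v ^ n) \<in> polyfuns"
  by (induction n) (auto intro: polyfuns.intros)

lemma eval_poly_in_polyfuns: "eval_poly p \<in> polyfuns"
proof -
  have "(\<lambda>v. \<Sum>a\<in>Poly_Mapping.keys p. Poly_Mapping.lookup p a *
      (\<Prod>i\<in>Poly_Mapping.keys a. v i ^ Poly_Mapping.lookup a i)) \<in> polyfuns"
    by (intro polyfuns_sum polyfuns_prod polyfuns_power polyfuns.intros)
  then show ?thesis
    unfolding eval_poly_def[abs_def] eval_monom_def[abs_def] .
qed

lemma polyfuns_along_curve:
  assumes "f \<in> polyfuns"
  shows "\<exists>R. \<forall>t. f (\<lambda>i. poly (P i) t) = poly R t"
  using assms
proof induction
  case (const c)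
  show ?case by (rule exI[of _ "[:c:]"]) simp
next
  case (coord i)
  show ?case by blast
next
  case (add f g)
  then show ?case by (metis poly_add)
next
  case (mult f g)
  then show ?case by (metis poly_mult)
qed

text \<open>
  The Taylor expansion of a polynomial function at \<open>a\<close>: as a polynomial in \<open>t\<close>, \<open>f (a + t w)\<close> has
  bounded degree, and its coefficients are polynomial functions of the direction \<open>w\<close>.
\<close>

lemma polyfuns_expand:
  assumes "f \<in> polyfuns"
  shows "\<exists>G D. (\<forall>w t. f (\<lambda>i. a i + t * w i) = poly (G w) t) \<and>
    (\<forall>j. (\<lambda>w. coeff (G w) j) \<in> polyfuns) \<and> (\<forall>w. degree (G w) \<le> D)"
  using assms
proof induction
  case (const c)
  show ?case
    by (rule exI[of _ "\<lambda>w. [:c:]"], rule exI[of _ 0]) (auto intro: polyfuns.intros)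
next
  case (coord i)
  have "(\<lambda>w. coeff [:a i, w i:] j) \<in> polyfuns" for j
    by (cases j; cases "j - 1") (auto intro: polyfuns.intros)
  then show ?case
    by (intro exI[of _ "\<lambda>w. [:a i, w i:]"] exI[of _ 1]) auto
next
  case (add f g)
  then obtain G D G' D' where
    "\<forall>w t. f (\<lambda>i. a i + t * w i) = poly (G w) t" "\<forall>j. (\<lambda>w. coeff (G w) j) \<in> polyfuns"
    "\<forall>w. degree (G w) \<le> D"
    "\<forall>w t. g (\<lambda>i. a i + t * w i) = poly (G' w) t" "\<forall>j. (\<lambda>w. coeff (G' w) j) \<in> polyfuns"
    "\<forall>w. degree (G' w) \<le> D'" by blast
  then show ?case
    by (intro exI[of _ "\<lambda>w. G w + G' w"] exI[of _ "max D D'"])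
       (auto intro!: polyfuns.intros degree_add_le intro: le_max_iff_disj[THEN iffD2])
next
  case (mult f g)
  then obtain G D G' D' where
    *: "\<forall>w t. f (\<lambda>i. a i + t * w i) = poly (G w) t" "\<forall>j. (\<lambda>w. coeff (G w) j) \<in> polyfuns"
    "\<forall>w. degree (G w) \<le> D"
    "\<forall>w t. g (\<lambda>i. a i + t * w i) = poly (G' w) t" "\<forall>j. (\<lambda>w. coeff (G' w) j) \<in> polyfuns"
    "\<forall>w. degree (G' w) \<le> D'" by blast
  have "degree (G w * G' w) \<le> D + D'" for w
    using * degree_mult_le[of "G w" "G' w"] by (meson add_mono order_trans)
  moreover have "(\<lambda>w. coeff (G w * G' w) j) \<in> polyfuns" for j
    unfolding coeff_mult using * by (intro polyfuns_sum polyfuns.mult) auto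
  ultimately show ?case
    using * by (intro exI[of _ "\<lambda>w. G w * G' w"] exI[of _ "D + D'"]) auto
qed

lemma poly_zero_of_infinite_roots:
  fixes p :: "complex poly"
  assumes "infinite E" "\<And>t. t \<in> E \<Longrightarrow> poly p t = 0"
  shows "p = 0"
  using assms poly_roots_finite[of p] by (metis (mono_tags) finite_subset mem_Collect_eq subsetI)

text \<open>
  Let \<open>f\<close> vanish at infinitely many points of some polynomial curve through \<open>a\<close> in every direction
  \<open>w\<close>.  If the Taylor expansion of \<open>f\<close> at \<open>a\<close> had a nonzero term, its lowest homogeneous part would
  be nonzero at some \<open>w\<close>; but that value is the lowest coefficient of \<open>f\<close> along the curve.
\<close>

lemma polyfun_vanishes_of_curves:
  assumes f: "f \<in> polyfuns" and a: "a \<in> coord_space I"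
    and curves: "\<And>w. w \<in> coord_space I \<Longrightarrow> \<exists>P E. infinite E \<and> (\<forall>i. poly (P i) 0 = w i) \<and>
        (\<forall>t. (\<lambda>i. poly (P i) t) \<in> coord_space I) \<and>
        (\<forall>t\<in>E. f (\<lambda>i. a i + t * poly (P i) t) = 0)"
    and v: "v \<in> coord_space I"
  shows "f v = 0"
proof (rule ccontr)
  assume nz: "f v \<noteq> 0"
  obtain G D where G: "\<And>w t. f (\<lambda>i. a i + t * w i) = poly (G w) t"
    "\<And>j. (\<lambda>w. coeff (G w) j) \<in> polyfuns" "\<And>w. degree (G w) \<le> D"
    using polyfuns_expand[OF f, of a] by metis
  define w0 where "w0 = (\<lambda>i. v i - a i)"
  have w0: "w0 \<in> coord_space I"
    using a v by (simp add: w0_def coord_space_def)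
  have "poly (G w0) 1 = f v"
    using G(1)[of 1 w0] by (simp add: w0_def)
  then have "G w0 \<noteq> 0" using nz by auto
  then have ex: "\<exists>k. \<exists>w\<in>coord_space I. coeff (G w) k \<noteq> 0"
    using w0 by (metis leading_coeff_0_iff)
  define k where "k = (LEAST k. \<exists>w\<in>coord_space I. coeff (G w) k \<noteq> 0)"
  obtain w where w: "w \<in> coord_space I" "coeff (G w) k \<noteq> 0"
    using LeastI_ex[OF ex] unfolding k_def by blast
  have low: "coeff (G u) j = 0" if "u \<in> coord_space I" "j < k" for u j
    using not_less_Least[of j] that unfolding k_def by blast
  have kD: "k \<le> D" using w(2) G(3)[of w] by (meson le_degree order_trans)
  obtain P E where P: "infinite E" "\<And>i. poly (P i) 0 = w i"
      "\<And>t. (\<lambda>i. poly (P i) t) \<in> coord_space I"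
      "\<And>t. t \<in> E \<Longrightarrow> f (\<lambda>i. a i + t * poly (P i) t) = 0"
    using curves[OF w(1)] by blast
  have "\<forall>j. \<exists>R. \<forall>t. coeff (G (\<lambda>i. poly (P i) t)) j = poly R t"
    using polyfuns_along_curve[OF G(2)] by blast
  then obtain R where R: "\<And>j t. coeff (G (\<lambda>i. poly (P i) t)) j = poly (R j) t"
    by metis
  \<comment> \<open>Along the curve \<open>f\<close> equals \<open>t\<^sup>k h(t)\<close>, where \<open>h(0)\<close> is the part of degree \<open>k\<close> evaluated at \<open>w\<close>.\<close>
  define h where "h = (\<Sum>j=k..D. R j * monom 1 (j - k))"
  have eq: "f (\<lambda>i. a i + t * poly (P i) t) = t ^ k * poly h t" for t
  proof -
    let ?g = "G (\<lambda>i. poly (P i) t)"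
    have "f (\<lambda>i. a i + t * poly (P i) t) = poly ?g t" by (rule G(1))
    also have "\<dots> = (\<Sum>j\<le>D. coeff ?g j * t ^ j)"
      unfolding poly_altdef[of ?g] using G(3)[of "\<lambda>i. poly (P i) t"]
      by (intro sum.mono_neutral_left) (auto simp: coeff_eq_0)
    also have "\<dots> = (\<Sum>j=k..D. coeff ?g j * t ^ j)"
      by (rule sum.mono_neutral_right) (auto simp: low[OF P(3)])
    also have "\<dots> = (\<Sum>j=k..D. t ^ k * (poly (R j) t * t ^ (j - k)))"
      by (intro sum.cong refl) (simp add: R power_add[symmetric] mult.left_commute)
    also have "\<dots> = t ^ k * poly h t"
      by (simp add: h_def poly_sum poly_monom sum_distrib_left)
    finally show ?thesis .
  qed
  have "h = 0"
  proof (rule poly_zero_of_infinite_roots)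
    show "infinite (E - {0})" using P(1) by simp
    show "poly h t = 0" if "t \<in> E - {0}" for t
      using eq[of t] P(4)[of t] that by simp
  qed
  moreover have "poly h 0 = coeff (G w) k"
  proof -
    have "poly h 0 = (\<Sum>j=k..D. if j = k then poly (R k) 0 else 0)"
      unfolding h_def poly_sum by (intro sum.cong) (auto simp: poly_monom)
    also have "\<dots> = coeff (G w) k"
      using kD R[of 0 k] by (simp add: P(2))
    finally show ?thesis .
  qed
  ultimately show False using w(2) by simp
qed

section \<open>Irreducible sets and linear subspaces\<close>

lemma proj_point_self: "v \<in> proj_point v"
  unfolding in_proj_point_iff by (rule exI[of _ 1]) simp

lemma proj_point_in_proj_space_iff:
  "proj_point v \<in> proj_space I \<longleftrightarrow> v \<in> coord_space I - {0}"
proof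
  assume "proj_point v \<in> proj_space I"
  then obtain w where w: "w \<in> coord_space I" "w \<noteq> 0" "proj_point v = proj_point w"
    by (auto simp: proj_space_def)
  then obtain c d where c: "v = (\<lambda>i. c * w i)" and d: "w = (\<lambda>i. d * v i)"
    using proj_point_self in_proj_point_iff by metis
  have "v \<noteq> 0" using d w(2) by (auto simp: zero_fun_def)
  then show "v \<in> coord_space I - {0}" using c w(1) by (simp add: coord_space_def)
qed (auto simp: proj_space_def)

lemma proj_point_in_zero_locus_iff:
  assumes "F \<subseteq> homogeneous_polys I"
  shows "proj_point v \<in> zero_locus I F \<longleftrightarrow>
    v \<in> coord_space I - {0} \<and> (\<forall>p\<in>F. eval_poly p v = 0)"
  using assms vanishes_at_point_iff[of _ I v]
  by (auto simp: zero_locus_def proj_point_in_proj_space_iff)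

lemma subtopology_zariski_proj_space: "subtopology (zariski I) (proj_space I) = zariski I"
  using subtopology_topspace[of "zariski I"] by simp

text \<open>
  A set of points is irreducible if any two of its points lie on a polynomial curve inside the set: two
  polynomials, each nonzero at one of the two points, have a product that is nonzero along the curve.
  The curve may pass through the origin, which is not a point of projective space.
\<close>

lemma irreducible_of_curves:
  assumes S: "S \<subseteq> coord_space I - {0}" "S \<noteq> {}"
    and curves: "\<And>u v. u \<in> S \<Longrightarrow> v \<in> S \<Longrightarrow> \<exists>P. (\<forall>i. poly (P i) 0 = u i) \<and> (\<forall>i. poly (P i) 1 = v i) \<and>
       (\<forall>t. (\<lambda>i. poly (P i) t) \<noteq> 0 \<longrightarrow> (\<lambda>i. poly (P i) t) \<in> S)"
  shows "irreducible_space (subtopology (zariski I) (proj_point ` S))"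
proof -
  let ?X = "proj_point ` S"
  have sub: "?X \<subseteq> proj_space I" using S by (auto simp: proj_space_def)
  then have top: "topspace (subtopology (zariski I) ?X) = ?X"
    by (auto simp: topspace_subtopology)
  have "A = ?X \<or> B = ?X"
    if AB: "closedin (subtopology (zariski I) ?X) A" "closedin (subtopology (zariski I) ?X) B"
      "A \<union> B = ?X" for A B
  proof (rule ccontr)
    assume neg: "\<not> (A = ?X \<or> B = ?X)"
    obtain F G where F: "F \<subseteq> homogeneous_polys I" "A = zero_locus I F \<inter> ?X"
      and G: "G \<subseteq> homogeneous_polys I" "B = zero_locus I G \<inter> ?X"
      using AB(1,2) unfolding closedin_subtopology closedin_zariski by blast
    have outside: "\<exists>u\<in>S. \<exists>p\<in>H. eval_poly p u \<noteq> 0"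
      if H: "H \<subseteq> homogeneous_polys I" "zero_locus I H \<inter> ?X \<noteq> ?X" for H
    proof -
      obtain u where "u \<in> S" "proj_point u \<notin> zero_locus I H" using H(2) by blast
      then show ?thesis
        using S(1) unfolding proj_point_in_zero_locus_iff[OF H(1)] by blast
    qed
    obtain u p where u: "u \<in> S" "p \<in> F" "eval_poly p u \<noteq> 0"
      using outside[OF F(1)] F(2) neg by metis
    obtain v q where v: "v \<in> S" "q \<in> G" "eval_poly q v \<noteq> 0"
      using outside[OF G(1)] G(2) neg by metis
    obtain P where P: "\<And>i. poly (P i) 0 = u i" "\<And>i. poly (P i) 1 = v i"
      "\<And>t. (\<lambda>i. poly (P i) t) \<noteq> 0 \<Longrightarrow> (\<lambda>i. poly (P i) t) \<in> S"
      using curves[OF u(1) v(1)] by blast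
    obtain R where R: "\<And>t. eval_poly p (\<lambda>i. poly (P i) t) = poly R t"
      using polyfuns_along_curve[OF eval_poly_in_polyfuns] by blast
    obtain R' where R': "\<And>t. eval_poly q (\<lambda>i. poly (P i) t) = poly R' t"
      using polyfuns_along_curve[OF eval_poly_in_polyfuns] by blast
    have "u \<noteq> 0" using u(1) S by auto
    then obtain i where i: "u i \<noteq> 0" by (auto simp: fun_eq_iff)
    have "R \<noteq> 0" "R' \<noteq> 0" using R[of 0] R'[of 1] P(1,2) u v by auto
    moreover have "P i \<noteq> 0" using P(1)[of i] i by auto
    ultimately have "R * R' * P i \<noteq> 0" by simp
    then obtain t where "poly (R * R' * P i) t \<noteq> 0"
      using poly_all_0_iff_0 by blast
    then have t: "poly R t \<noteq> 0" "poly R' t \<noteq> 0" "poly (P i) t \<noteq> 0" by auto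
    let ?w = "\<lambda>i. poly (P i) t"
    have w: "?w \<in> S" using P(3)[of t] t(3) by (auto simp: fun_eq_iff)
    then have "proj_point ?w \<in> zero_locus I F \<or> proj_point ?w \<in> zero_locus I G"
      using AB(3) F G by blast
    then show False
      using proj_point_in_zero_locus_iff[OF F(1)] proj_point_in_zero_locus_iff[OF G(1)]
        u(2) v(2) R[of t] R'[of t] t by auto
  qed
  moreover have "?X \<noteq> {}" using S(2) by simp
  ultimately show ?thesis
    unfolding irreducible_space_def top by (intro conjI allI impI) (assumption, elim conjE)
qed

lemma krull_dim_ge:
  assumes "\<And>i. i \<le> k \<Longrightarrow> closedin X (Z i)" "\<And>i. i \<le> k \<Longrightarrow> irreducible_space (subtopology X (Z i))"
    "\<And>i. i < k \<Longrightarrow> Z i \<subset> Z (Suc i)"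
  shows "enat k \<le> krull_dim X"
  unfolding krull_dim_def using assms by (intro SUP_upper) blast

lemma krull_dim_le:
  assumes "\<And>k Z. (\<And>i. i \<le> k \<Longrightarrow> closedin X (Z i)) \<Longrightarrow>
    (\<And>i. i \<le> k \<Longrightarrow> irreducible_space (subtopology X (Z i))) \<Longrightarrow>
    (\<And>i. i < k \<Longrightarrow> Z i \<subset> Z (Suc i)) \<Longrightarrow> k \<le> N"
  shows "krull_dim X \<le> enat N"
  unfolding krull_dim_def using assms by (intro SUP_least) auto

text \<open>
  The \<open>i\<close>-th coordinate as a linear form.
\<close>

definition coord_poly :: "'i \<Rightarrow> 'i cpoly" where
  "coord_poly i = Poly_Mapping.single (Poly_Mapping.single i 1) 1"

lemma eval_coord_poly [simp]: "eval_poly (coord_poly i) v = v i"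
  by (simp add: coord_poly_def eval_poly_single eval_monom_def)

lemma coord_poly_homogeneous: "i \<in> I \<Longrightarrow> coord_poly i \<in> homogeneous_polys I"
  by (auto simp: coord_poly_def homogeneous_polys_def total_degree_def)

lemma coord_subspace_zero_locus:
  assumes "J \<subseteq> I"
  shows "proj_space J = zero_locus I (coord_poly ` (I - J))"
proof -
  have F: "coord_poly ` (I - J) \<subseteq> homogeneous_polys I"
    by (auto intro: coord_poly_homogeneous)
  have "coord_space J = {v \<in> coord_space I. \<forall>i\<in>I-J. v i = 0}"
    using assms by (auto simp: coord_space_def)
  then have "proj_point v \<in> proj_space J \<longleftrightarrow> proj_point v \<in> zero_locus I (coord_poly ` (I - J))" for v
    unfolding proj_point_in_proj_space_iff proj_point_in_zero_locus_iff[OF F] by auto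
  moreover have "zero_locus I (coord_poly ` (I - J)) \<subseteq> range proj_point" "proj_space J \<subseteq> range proj_point"
    by (auto simp: zero_locus_def proj_space_def)
  ultimately show ?thesis by blast
qed

text \<open>
  The \<open>j\<close>-th standard basis vector.
\<close>

definition unit_vec :: "'i \<Rightarrow> 'i \<Rightarrow> complex" where
  "unit_vec j = (\<lambda>i. if i = j then 1 else 0)"

lemma unit_vec_in_coord_space: "j \<in> I \<Longrightarrow> unit_vec j \<in> coord_space I - {0}"
  by (auto simp: unit_vec_def coord_space_def fun_eq_iff)

lemma krull_dim_proj_space_ge:
  assumes "finite I" "I \<noteq> {}"
  shows "enat (card I - 1) \<le> krull_dim (zariski I)"
proof -
  obtain h where h: "bij_betw h {..<card I} I"
    using ex_bij_betw_nat_finite[OF assms(1)] atLeast0LessThan by metis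
  define J where "J i = h ` {..i}" for i
  have J: "J i \<subseteq> I" if "i \<le> card I - 1" for i
  proof -
    have "card I > 0" using assms by (simp add: card_gt_0_iff)
    then have "{..i} \<subseteq> {..<card I}" using that by auto
    then show ?thesis using h unfolding J_def bij_betw_def by blast
  qed
  show ?thesis
  proof (rule krull_dim_ge[where Z = "\<lambda>i. proj_space (J i)"])
    fix i assume i: "i \<le> card I - 1"
    show "closedin (zariski I) (proj_space (J i))"
      unfolding closedin_zariski coord_subspace_zero_locus[OF J[OF i]]
      by (rule exI[of _ "coord_poly ` (I - J i)"]) (auto intro: coord_poly_homogeneous)
    show "irreducible_space (subtopology (zariski I) (proj_space (J i)))"
      unfolding proj_space_def
    proof (rule irreducible_of_curves)
      show "coord_space (J i) - {0} \<subseteq> coord_space I - {0}"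
        using J[OF i] by (auto simp: coord_space_def)
      show "coord_space (J i) - {0} \<noteq> {}"
        using unit_vec_in_coord_space[of "h i" "J i"] by (auto simp: J_def)
      fix u v assume "u \<in> coord_space (J i) - {0}" "v \<in> coord_space (J i) - {0}"
      then show "\<exists>P. (\<forall>i. poly (P i) 0 = u i) \<and> (\<forall>i. poly (P i) 1 = v i) \<and>
       (\<forall>t. (\<lambda>i. poly (P i) t) \<noteq> 0 \<longrightarrow> (\<lambda>i. poly (P i) t) \<in> coord_space (J i) - {0})"
        by (intro exI[of _ "\<lambda>i. [:u i, v i - u i:]"]) (auto simp: coord_space_def)
    qed
  next
    fix i assume i: "i < card I - 1"
    have "J i \<subseteq> J (Suc i)" by (auto simp: J_def)
    then have "proj_space (J i) \<subseteq> proj_space (J (Suc i))"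
      by (auto simp: proj_space_def coord_space_def)
    moreover have "h (Suc i) \<notin> J i"
    proof
      assume "h (Suc i) \<in> J i"
      then obtain j where "j \<le> i" "h j = h (Suc i)" by (auto simp: J_def)
      moreover have "Suc i < card I" using i by linarith
      ultimately show False
        using inj_onD[OF bij_betw_imp_inj_on[OF h] \<open>h j = h (Suc i)\<close>] by simp
    qed
    then have "unit_vec (h (Suc i)) \<notin> coord_space (J i)"
      unfolding coord_space_def unit_vec_def by force
    then have "proj_point (unit_vec (h (Suc i))) \<notin> proj_space (J i)"
      unfolding proj_point_in_proj_space_iff by blast
    moreover have "proj_point (unit_vec (h (Suc i))) \<in> proj_space (J (Suc i))"
      unfolding proj_point_in_proj_space_iff by (rule unit_vec_in_coord_space) (auto simp: J_def)
    ultimately show "proj_space (J i) \<subset> proj_space (J (Suc i))" by blast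
  qed
qed

section \<open>The dimension of projective space\<close>

text \<open>
  The functions on \<open>\<complex>\<^bsup>I\<^esup>\<close> given by homogeneous polynomials of degree \<open>d\<close> in the coordinates in \<open>I\<close>.
  Passing to functions loses nothing here and turns a form into an element of a vector space of
  functions.  The zero function is a form of every degree.
\<close>

definition forms :: "'i set \<Rightarrow> nat \<Rightarrow> (('i \<Rightarrow> complex) \<Rightarrow> complex) set" where
  "forms I d = {eval_poly p |p. \<forall>a\<in>Poly_Mapping.keys p. Poly_Mapping.keys a \<subseteq> I \<and> total_degree a = d}"

lemma total_degree_superset:
  "finite S \<Longrightarrow> Poly_Mapping.keys a \<subseteq> S \<Longrightarrow> total_degree a = (\<Sum>i\<in>S. Poly_Mapping.lookup a i)"
  unfolding total_degree_def by (intro sum.mono_neutral_left) (auto simp: in_keys_iff)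

lemma total_degree_add: "total_degree (a + b) = total_degree a + total_degree b"
  unfolding total_degree_def by (rule setsum_keys_plus_distrib) auto

lemma forms_mult:
  assumes "f \<in> forms I d" "g \<in> forms I e"
  shows "(\<lambda>v. f v * g v) \<in> forms I (d + e)"
proof -
  obtain p where p: "f = eval_poly p"
    "\<And>a. a \<in> Poly_Mapping.keys p \<Longrightarrow> Poly_Mapping.keys a \<subseteq> I \<and> total_degree a = d"
    using assms(1) by (auto simp: forms_def)
  obtain q where q: "g = eval_poly q"
    "\<And>a. a \<in> Poly_Mapping.keys q \<Longrightarrow> Poly_Mapping.keys a \<subseteq> I \<and> total_degree a = e"
    using assms(2) by (auto simp: forms_def)
  have "Poly_Mapping.keys c \<subseteq> I \<and> total_degree c = d + e" if c: "c \<in> Poly_Mapping.keys (p * q)" for c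
  proof -
    obtain a b where ab: "c = a + b" "a \<in> Poly_Mapping.keys p" "b \<in> Poly_Mapping.keys q"
      using c keys_mult[of p q] by blast
    show ?thesis
      using p(2)[OF ab(2)] q(2)[OF ab(3)] Poly_Mapping.keys_add[of a b]
      unfolding ab(1) total_degree_add by blast
  qed
  moreover have "(\<lambda>v. f v * g v) = eval_poly (p * q)"
    by (simp add: fun_eq_iff p(1) q(1) eval_poly_mult)
  ultimately show ?thesis unfolding forms_def by blast
qed

lemma forms_add:
  assumes "f \<in> forms I d" "g \<in> forms I d"
  shows "(\<lambda>v. f v + g v) \<in> forms I d"
proof -
  obtain p where p: "f = eval_poly p"
    "\<And>a. a \<in> Poly_Mapping.keys p \<Longrightarrow> Poly_Mapping.keys a \<subseteq> I \<and> total_degree a = d"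
    using assms(1) by (auto simp: forms_def)
  obtain q where q: "g = eval_poly q"
    "\<And>a. a \<in> Poly_Mapping.keys q \<Longrightarrow> Poly_Mapping.keys a \<subseteq> I \<and> total_degree a = d"
    using assms(2) by (auto simp: forms_def)
  have "Poly_Mapping.keys a \<subseteq> I \<and> total_degree a = d" if "a \<in> Poly_Mapping.keys (p + q)" for a
    using that Poly_Mapping.keys_add[of p q] p(2) q(2) by blast
  moreover have "(\<lambda>v. f v + g v) = eval_poly (p + q)"
    by (simp add: fun_eq_iff p(1) q(1) eval_poly_add)
  ultimately show ?thesis unfolding forms_def by blast
qed

lemma forms_zero: "(\<lambda>v. 0) \<in> forms I d"
  unfolding forms_def by (auto intro!: exI[of _ 0])

lemma forms_const: "(\<lambda>v. c) \<in> forms I 0"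
  unfolding forms_def
  by (auto intro!: exI[of _ "Poly_Mapping.single 0 c"]
      simp: eval_poly_single eval_monom_def total_degree_def split: if_splits)

lemma forms_coord: "i \<in> I \<Longrightarrow> (\<lambda>v. v i) \<in> forms I 1"
proof -
  assume "i \<in> I"
  then have "\<forall>a\<in>Poly_Mapping.keys (coord_poly i). Poly_Mapping.keys a \<subseteq> I \<and> total_degree a = 1"
    by (simp add: coord_poly_def total_degree_def)
  moreover have "(\<lambda>v. v i) = eval_poly (coord_poly i)" by (simp add: fun_eq_iff)
  ultimately show ?thesis unfolding forms_def by blast
qed

lemma forms_sum:
  assumes "\<And>a. a \<in> A \<Longrightarrow> f a \<in> forms I d"
  shows "(\<lambda>v. \<Sum>a\<in>A. f a v) \<in> forms I d"
  using assms by (induction A rule: infinite_finite_induct) (auto intro: forms_add forms_zero)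

lemma forms_power: "f \<in> forms I d \<Longrightarrow> (\<lambda>v. f v ^ n) \<in> forms I (n * d)"
proof (induction n)
  case (Suc n)
  then show ?case using forms_mult[of f I d "\<lambda>v. f v ^ n" "n * d"] by simp
qed (simp add: forms_const)

lemma forms_prod:
  assumes "\<And>a. a \<in> A \<Longrightarrow> f a \<in> forms I (d a)"
  shows "(\<lambda>v. \<Prod>a\<in>A. f a v) \<in> forms I (\<Sum>a\<in>A. d a)"
  using assms
proof (induction A rule: infinite_finite_induct)
  case (insert a A)
  then show ?case using forms_mult[of "f a" I "d a" "\<lambda>v. \<Prod>a\<in>A. f a v"] by simp
qed (simp_all add: forms_const)

lemma forms_monomial:
  assumes "\<And>i. i \<in> A \<Longrightarrow> f i \<in> forms I d"
  shows "(\<lambda>v. \<Prod>i\<in>A. f i v ^ e i) \<in> forms I ((\<Sum>i\<in>A. e i) * d)"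
  unfolding sum_distrib_right using assms by (intro forms_prod forms_power)

lemma forms_iff_homogeneous:
  "(\<exists>d. f \<in> forms I d) \<longleftrightarrow> (\<exists>p\<in>homogeneous_polys I. f = eval_poly p)"
  unfolding forms_def homogeneous_polys_def by blast

lemma irreducible_forms_mult:
  assumes Z: "Z \<subseteq> proj_space I" "irreducible_space (subtopology (zariski I) Z)"
    and fg: "f \<in> forms I d" "g \<in> forms I e"
    and zero: "\<And>v. proj_point v \<in> Z \<Longrightarrow> f v * g v = 0"
  shows "(\<forall>v. proj_point v \<in> Z \<longrightarrow> f v = 0) \<or> (\<forall>v. proj_point v \<in> Z \<longrightarrow> g v = 0)"
proof -
  obtain p q where p: "p \<in> homogeneous_polys I" "f = eval_poly p"
    and q: "q \<in> homogeneous_polys I" "g = eval_poly q"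
    using fg forms_iff_homogeneous by metis
  have top: "topspace (subtopology (zariski I) Z) = Z"
    using Z(1) by (auto simp: topspace_subtopology)
  have mem: "proj_point v \<in> zero_locus I {r} \<inter> Z \<longleftrightarrow> proj_point v \<in> Z \<and> eval_poly r v = 0"
    if "r \<in> homogeneous_polys I" for r v
    using that Z(1) proj_point_in_zero_locus_iff[of "{r}" I v]
      proj_point_in_proj_space_iff[of v I] by auto
  have cl: "closedin (subtopology (zariski I) Z) (zero_locus I {r} \<inter> Z)"
    if "r \<in> homogeneous_polys I" for r
    unfolding closedin_subtopology closedin_zariski using that by (intro exI conjI) auto
  have "z \<in> zero_locus I {p} \<inter> Z \<union> zero_locus I {q} \<inter> Z" if z: "z \<in> Z" for z
  proof -
    obtain v where "z = proj_point v" using z Z(1) by (auto simp: proj_space_def)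
    then show ?thesis
      using mem[OF p(1), of v] mem[OF q(1), of v] zero[of v] z p(2) q(2) by auto
  qed
  then have "zero_locus I {p} \<inter> Z \<union> zero_locus I {q} \<inter> Z = Z" by blast
  then have "zero_locus I {p} \<inter> Z = Z \<or> zero_locus I {q} \<inter> Z = Z"
    using Z(2) cl[OF p(1)] cl[OF q(1)] unfolding irreducible_space_def top by metis
  then show ?thesis
    using mem[OF p(1)] mem[OF q(1)] p(2) q(2) by metis
qed

text \<open>
  The functions \<open>f 0, \<dots>, f k\<close> satisfy no nontrivial homogeneous algebraic relation on the cone over
  \<open>Z\<close>.  The exponents of a monomial are a function \<open>e\<close> that vanishes beyond \<open>k\<close>, so that distinct
  elements of \<open>E\<close> are distinct monomials.  Only monomials of one degree \<open>N\<close> are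
  compared: for forms of equal degree a relation is then a form again, and irreducibility of \<open>Z\<close> can
  be applied to its factors.
\<close>

definition alg_independent_on ::
  "('i \<Rightarrow> complex) set set \<Rightarrow> (nat \<Rightarrow> ('i \<Rightarrow> complex) \<Rightarrow> complex) \<Rightarrow> nat \<Rightarrow> bool" where
  "alg_independent_on Z f k \<longleftrightarrow>
     (\<forall>N E c. finite E \<longrightarrow> (\<forall>e\<in>E. (\<Sum>i\<le>k. e i) = N \<and> (\<forall>i>k. e i = (0::nat))) \<longrightarrow>
       (\<forall>v. proj_point v \<in> Z \<longrightarrow> (\<Sum>e\<in>E. c e * (\<Prod>i\<le>k. f i v ^ e i)) = (0::complex)) \<longrightarrow>
       (\<forall>e\<in>E. c e = 0))"

lemma alg_independent_on_0:
  assumes "proj_point v \<in> Z" "f 0 v \<noteq> 0"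
  shows "alg_independent_on Z f 0"
  unfolding alg_independent_on_def
proof (intro allI impI ballI)
  fix N E and c :: "(nat \<Rightarrow> nat) \<Rightarrow> complex" and e
  assume E: "finite E" "\<forall>e\<in>E. (\<Sum>i\<le>0. e i) = N \<and> (\<forall>i>0. e i = 0)"
    and rel: "\<forall>v. proj_point v \<in> Z \<longrightarrow> (\<Sum>e\<in>E. c e * (\<Prod>i\<le>0. f i v ^ e i)) = 0"
    and e: "e \<in> E"
  have "e' = e" if "e' \<in> E" for e'
  proof
    have *: "x 0 = N \<and> (\<forall>i>0. x i = 0)" if "x \<in> E" for x using E(2) that by simp
    show "e' i = e i" for i using *[OF e] *[OF that] by (cases "i = 0") simp_all
  qed
  then have "E = {e}" using e by blast
  then have "c e * f 0 v ^ e 0 = 0" using rel assms(1) by simp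
  then show "c e = 0" using assms(2) by simp
qed

text \<open>
  A form that vanishes on \<open>Z\<close> but not on the larger irreducible set \<open>Z'\<close> is independent of forms that
  are independent on \<open>Z\<close>: after cancelling the highest power of it that divides a relation on \<open>Z'\<close>,
  restriction to \<open>Z\<close> leaves a nontrivial relation between the old forms.
\<close>

lemma alg_independent_on_Suc:
  assumes ind: "alg_independent_on Z f k" and sub: "Z \<subseteq> Z'"
    and Z': "Z' \<subseteq> proj_space I" "irreducible_space (subtopology (zariski I) Z')"
    and f: "\<And>i. i \<le> Suc k \<Longrightarrow> f i \<in> forms I d"
    and van: "\<And>v. proj_point v \<in> Z \<Longrightarrow> f (Suc k) v = 0"
    and w: "proj_point w \<in> Z'" "f (Suc k) w \<noteq> 0"
  shows "alg_independent_on Z' f (Suc k)"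
  unfolding alg_independent_on_def
proof (intro allI impI, rule ccontr)
  fix N E and c :: "(nat \<Rightarrow> nat) \<Rightarrow> complex"
  assume E: "finite E" "\<forall>e\<in>E. (\<Sum>i\<le>Suc k. e i) = N \<and> (\<forall>i>Suc k. e i = 0)"
    and rel: "\<forall>v. proj_point v \<in> Z' \<longrightarrow> (\<Sum>e\<in>E. c e * (\<Prod>i\<le>Suc k. f i v ^ e i)) = 0"
    and "\<not> (\<forall>e\<in>E. c e = 0)"
  define E0 where "E0 = {e \<in> E. c e \<noteq> 0}"
  have E0: "finite E0" "E0 \<noteq> {}" using E(1) \<open>\<not> (\<forall>e\<in>E. c e = 0)\<close> by (auto simp: E0_def)
  define j where "j = Min ((\<lambda>e. e (Suc k)) ` E0)"
  have j_le: "j \<le> e (Suc k)" if "e \<in> E0" for e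
    using E0 that by (auto simp: j_def)
  have "j \<in> (\<lambda>e. e (Suc k)) ` E0" unfolding j_def using E0 by (intro Min_in) auto
  then obtain e0 where e0: "e0 \<in> E0" "e0 (Suc k) = j" by blast
  let ?F = "f (Suc k)"
  define G where "G v = (\<Sum>e\<in>E0. (c e * (\<Prod>i\<le>k. f i v ^ e i)) * ?F v ^ (e (Suc k) - j))" for v
  have Gform: "G \<in> forms I ((N - j) * d)"
    unfolding G_def[abs_def]
  proof (rule forms_sum)
    fix e assume e: "e \<in> E0"
    then have "(\<Sum>i\<le>k. e i) + e (Suc k) = N" using E(2) by (auto simp: E0_def)
    then have deg: "0 + (\<Sum>i\<le>k. e i) * d + (e (Suc k) - j) * d = (N - j) * d"
      using j_le[OF e] by (simp flip: add_mult_distrib)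
    show "(\<lambda>v. (c e * (\<Prod>i\<le>k. f i v ^ e i)) * ?F v ^ (e (Suc k) - j)) \<in> forms I ((N - j) * d)"
      unfolding deg[symmetric]
      by (intro forms_mult forms_const forms_monomial forms_power f) auto
  qed
  have FG: "?F v ^ j * G v = 0" if "proj_point v \<in> Z'" for v
  proof -
    have "?F v ^ j * G v = (\<Sum>e\<in>E0. c e * (\<Prod>i\<le>Suc k. f i v ^ e i))"
      unfolding G_def sum_distrib_left
    proof (rule sum.cong[OF refl])
      fix e assume "e \<in> E0"
      then have "?F v ^ e (Suc k) = ?F v ^ j * ?F v ^ (e (Suc k) - j)"
        using j_le by (simp flip: power_add)
      then show "?F v ^ j * (c e * (\<Prod>i\<le>k. f i v ^ e i) * ?F v ^ (e (Suc k) - j)) =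
          c e * (\<Prod>i\<le>Suc k. f i v ^ e i)"
        by (simp add: mult_ac)
    qed
    also have "\<dots> = (\<Sum>e\<in>E. c e * (\<Prod>i\<le>Suc k. f i v ^ e i))"
      using E(1) by (intro sum.mono_neutral_left) (auto simp: E0_def)
    finally show ?thesis using rel that by simp
  qed
  have "(\<forall>v. proj_point v \<in> Z' \<longrightarrow> ?F v ^ j = 0) \<or> (\<forall>v. proj_point v \<in> Z' \<longrightarrow> G v = 0)"
    using irreducible_forms_mult[OF Z' forms_power[OF f] Gform FG] by simp
  then have G0: "G v = 0" if "proj_point v \<in> Z'" for v
    using w that by (metis power_not_zero)
  define E1 where "E1 = {e \<in> E0. e (Suc k) = j}"
  define r where "r e = e(Suc k := 0)" for e :: "nat \<Rightarrow> nat"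
  have inj: "inj_on r E1"
  proof (rule inj_onI)
    fix a b assume ab: "a \<in> E1" "b \<in> E1" "r a = r b"
    have "x = (r x)(Suc k := j)" if "x \<in> E1" for x
      using that by (auto simp: r_def E1_def fun_eq_iff)
    then show "a = b" using ab by metis
  qed
  have "\<forall>e\<in>r ` E1. c (e(Suc k := j)) = 0"
  proof (rule ind[unfolded alg_independent_on_def, rule_format, of "r ` E1" "N - j" "\<lambda>e. c (e(Suc k := j))", THEN ballI])
    show "finite (r ` E1)" using E0(1) by (simp add: E1_def)
    show "(\<Sum>i\<le>k. e i) = N - j \<and> (\<forall>i>k. e i = 0)" if e: "e \<in> r ` E1" for e
    proof -
      obtain a where a: "a \<in> E" "a (Suc k) = j" "e = r a"
        using e by (auto simp: E1_def E0_def)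
      have "(\<Sum>i\<le>k. e i) = (\<Sum>i\<le>k. a i)" unfolding a(3) r_def by (intro sum.cong) auto
      then have "(\<Sum>i\<le>k. e i) = N - j" using E(2) a by auto
      moreover have "e i = 0" if "i > k" for i
        using that E(2) a by (cases "i = Suc k") (auto simp: r_def)
      ultimately show ?thesis by blast
    qed
    show "(\<Sum>e\<in>r ` E1. c (e(Suc k := j)) * (\<Prod>i\<le>k. f i v ^ e i)) = 0" if v: "proj_point v \<in> Z" for v
    proof -
      have "(\<Sum>e\<in>r ` E1. c (e(Suc k := j)) * (\<Prod>i\<le>k. f i v ^ e i)) =
          (\<Sum>e\<in>E1. c e * (\<Prod>i\<le>k. f i v ^ e i))"
        unfolding sum.reindex[OF inj]
        by (intro sum.cong arg_cong2[of _ _ _ _ "(*)"] prod.cong arg_cong[of _ _ c])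
           (auto simp: r_def E1_def fun_eq_iff)
      also have "\<dots> = (\<Sum>e\<in>E1. c e * (\<Prod>i\<le>k. f i v ^ e i) * ?F v ^ (e (Suc k) - j))"
        by (intro sum.cong) (auto simp: E1_def)
      also have "\<dots> = G v"
        unfolding G_def using E0(1) van[OF v] j_le
        by (intro sum.mono_neutral_left) (auto simp: E1_def le_less)
      finally show ?thesis using G0 sub v by auto
    qed
  qed
  moreover have "e0 \<in> E1" "(r e0)(Suc k := j) = e0"
    using e0 by (auto simp: E1_def r_def)
  ultimately have "c e0 = 0" by force
  then show False using e0(1) by (simp add: E0_def)
qed

lemma chain_alg_independent:
  assumes closed: "\<And>i. i \<le> k \<Longrightarrow> closedin (zariski I) (Z i)"
    and irr: "\<And>i. i \<le> k \<Longrightarrow> irreducible_space (subtopology (zariski I) (Z i))"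
    and strict: "\<And>i. i < k \<Longrightarrow> Z i \<subset> Z (Suc i)"
  shows "\<exists>f d. (\<forall>i\<le>k. f i \<in> forms I d) \<and> alg_independent_on (Z k) f k"
proof -
  have sub: "Z i \<subseteq> proj_space I" if "i \<le> k" for i
    using closedin_subset[OF closed[OF that]] by simp
  have "topspace (subtopology (zariski I) (Z 0)) \<noteq> {}"
    using irr[of 0] by (simp add: irreducible_space_def)
  then obtain u where u: "proj_point u \<in> Z 0"
    using sub[of 0] by (auto simp: topspace_subtopology proj_space_def)
  then have "u \<in> coord_space I - {0}"
    using sub[of 0] proj_point_in_proj_space_iff by blast
  then obtain i0 where i0: "i0 \<in> I" "u i0 \<noteq> 0"
    by (auto simp: coord_space_def fun_eq_iff)
  have u_in: "proj_point u \<in> Z i" if "i \<le> k" for i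
    using that
  proof (induction i)
    case (Suc i)
    then show ?case using strict[of i] by auto
  qed (rule u)
  have "\<exists>g d v. g \<in> forms I d \<and> (\<forall>w. proj_point w \<in> Z i \<longrightarrow> g w = 0) \<and>
      proj_point v \<in> Z (Suc i) \<and> g v \<noteq> 0" if i: "i < k" for i
  proof -
    obtain F where F: "F \<subseteq> homogeneous_polys I" "Z i = zero_locus I F"
      using closed[of i] i unfolding closedin_zariski by auto
    obtain z where z: "z \<in> Z (Suc i)" "z \<notin> Z i" using strict[OF i] by blast
    then obtain v where v: "z = proj_point v" using sub[of "Suc i"] i by (auto simp: proj_space_def)
    have "v \<in> coord_space I - {0}"
      using sub[of "Suc i"] i z(1) v proj_point_in_proj_space_iff by force
    then obtain p where p: "p \<in> F" "eval_poly p v \<noteq> 0"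
      using z(2) unfolding v F(2) proj_point_in_zero_locus_iff[OF F(1)] by blast
    moreover have "\<forall>w. proj_point w \<in> Z i \<longrightarrow> eval_poly p w = 0"
      using p(1) unfolding F(2) proj_point_in_zero_locus_iff[OF F(1)] by blast
    moreover obtain d where "eval_poly p \<in> forms I d"
      using forms_iff_homogeneous F(1) p(1) by (metis subsetD)
    ultimately show ?thesis using z(1) v by blast
  qed
  then obtain g d v where g: "\<And>i. i < k \<Longrightarrow> g i \<in> forms I (d i)"
    "\<And>i w. i < k \<Longrightarrow> proj_point w \<in> Z i \<Longrightarrow> g i w = 0"
    "\<And>i. i < k \<Longrightarrow> proj_point (v i) \<in> Z (Suc i)" "\<And>i. i < k \<Longrightarrow> g i (v i) \<noteq> 0"
    by metis
  \<comment> \<open>Multiplying by powers of a coordinate that does not vanish identically on \<open>Z 0\<close> makes all degrees equal.\<close>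
  define D where "D = (\<Sum>i<k. d i)"
  have dD: "d i \<le> D" if "i < k" for i
    using that member_le_sum[of i "{..<k}" d] by (simp add: D_def)
  define f where "f i = (if i = 0 then (\<lambda>v. v i0 ^ D) else (\<lambda>v. g (i - 1) v * v i0 ^ (D - d (i - 1))))" for i
  have f: "f i \<in> forms I D" if "i \<le> k" for i
  proof (cases "i = 0")
    case True
    then show ?thesis using forms_power[OF forms_coord[OF i0(1)], of D] by (simp add: f_def)
  next
    case False
    then have i: "i - 1 < k" using that by simp
    show ?thesis
      using False forms_mult[OF g(1)[OF i] forms_power[OF forms_coord[OF i0(1)], of "D - d (i - 1)"]]
        dD[OF i] by (simp add: f_def)
  qed
  have "alg_independent_on (Z i) f i" if "i \<le> k" for i
    using that
  proof (induction i)
    case 0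
    show ?case using u i0(2) by (intro alg_independent_on_0[of u]) (auto simp: f_def)
  next
    case (Suc i)
    then have i: "i < k" by simp
    have "\<exists>w. proj_point w \<in> Z (Suc i) \<and> f (Suc i) w \<noteq> 0"
    proof (rule ccontr)
      assume "\<not> ?thesis"
      then have "g i w * w i0 ^ (D - d i) = 0" if "proj_point w \<in> Z (Suc i)" for w
        using that by (simp add: f_def)
      from irreducible_forms_mult[OF sub[OF Suc.prems] irr[OF Suc.prems] g(1)[OF i]
          forms_power[OF forms_coord[OF i0(1)]] this]
      show False using g(3,4)[OF i] u_in[OF Suc.prems] i0(2) by (metis power_not_zero)
    qed
    then obtain w where w: "proj_point w \<in> Z (Suc i)" "f (Suc i) w \<noteq> 0" by blast
    show ?case
    proof (rule alg_independent_on_Suc[where f = f and Z' = "Z (Suc i)" and d = D and w = w])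
      show "alg_independent_on (Z i) f i" using Suc by simp
      show "Z i \<subseteq> Z (Suc i)" using strict[OF i] by blast
      show "f (Suc i) v = 0" if "proj_point v \<in> Z i" for v
        using g(2)[OF i that] by (simp add: f_def)
    qed (use Suc.prems sub irr f w in auto)
  qed
  then show ?thesis using f by blast
qed

lemma sum_fun_apply: "(\<Sum>a\<in>A. f a) v = (\<Sum>a\<in>A. f a v)"
  by (induction A rule: infinite_finite_induct) auto

text \<open>
  In a form of degree \<open>n\<close> the exponent of one variable is determined by the others.
\<close>

lemma card_exponents:
  assumes I: "finite I" "I \<noteq> {}"
  shows "finite {a. Poly_Mapping.keys a \<subseteq> I \<and> total_degree a = n} \<and>
    card {a. Poly_Mapping.keys a \<subseteq> I \<and> total_degree a = n} \<le> (n + 1) ^ (card I - 1)"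
proof -
  let ?A = "{a. Poly_Mapping.keys a \<subseteq> I \<and> total_degree a = n}"
  obtain i0 where i0: "i0 \<in> I" using I by blast
  let ?J = "I - {i0}"
  define \<phi> where "\<phi> a = restrict (Poly_Mapping.lookup a) ?J" for a :: "'a \<Rightarrow>\<^sub>0 nat"
  have deg: "Poly_Mapping.lookup a i0 + (\<Sum>i\<in>?J. Poly_Mapping.lookup a i) = n" if "a \<in> ?A" for a
    using that total_degree_superset[OF I(1), of a] sum.remove[OF I(1) i0, of "Poly_Mapping.lookup a"] by simp
  have inj: "inj_on \<phi> ?A"
  proof (rule inj_onI)
    fix a b assume ab: "a \<in> ?A" "b \<in> ?A" "\<phi> a = \<phi> b"
    have J: "Poly_Mapping.lookup a i = Poly_Mapping.lookup b i" if "i \<in> ?J" for i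
      using fun_cong[OF ab(3), of i] that by (simp add: \<phi>_def)
    then have "(\<Sum>i\<in>?J. Poly_Mapping.lookup a i) = (\<Sum>i\<in>?J. Poly_Mapping.lookup b i)"
      by (intro sum.cong) auto
    then have "Poly_Mapping.lookup a i0 = Poly_Mapping.lookup b i0"
      using deg[OF ab(1)] deg[OF ab(2)] by simp
    moreover have "Poly_Mapping.lookup a i = 0 \<and> Poly_Mapping.lookup b i = 0" if "i \<notin> I" for i
      using ab(1,2) that by (auto simp: in_keys_iff subset_iff)
    ultimately show "a = b" using J by (intro poly_mapping_eqI) (metis Diff_iff singletonD)
  qed
  have im: "\<phi> ` ?A \<subseteq> ?J \<rightarrow>\<^sub>E {..n}"
  proof
    fix x assume "x \<in> \<phi> ` ?A"
    then obtain a where a: "a \<in> ?A" "x = \<phi> a" by blast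
    have "Poly_Mapping.lookup a i \<le> n" if "i \<in> ?J" for i
      using deg[OF a(1)] member_le_sum[of i ?J "Poly_Mapping.lookup a"] that I(1) by simp
    then show "x \<in> ?J \<rightarrow>\<^sub>E {..n}" by (auto simp: a(2) \<phi>_def)
  qed
  have fin: "finite (?J \<rightarrow>\<^sub>E {..n})" using I by (intro finite_PiE) auto
  have "card (?J \<rightarrow>\<^sub>E {..n}) = (n + 1) ^ (card I - 1)"
    using I i0 by (simp add: card_PiE)
  then show ?thesis
    using card_inj_on_le[OF inj im fin] inj_on_finite[OF inj im fin] by simp
qed

lemma forms_subset_span:
  "forms I d \<subseteq> cspan (eval_monom ` {a. Poly_Mapping.keys a \<subseteq> I \<and> total_degree a = d})"
proof
  fix f assume "f \<in> forms I d"
  then obtain p where p: "f = eval_poly p"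
    "\<And>a. a \<in> Poly_Mapping.keys p \<Longrightarrow> Poly_Mapping.keys a \<subseteq> I \<and> total_degree a = d"
    by (auto simp: forms_def)
  have "f = (\<Sum>a\<in>Poly_Mapping.keys p. (\<lambda>v. Poly_Mapping.lookup p a * eval_monom a v))"
    by (auto simp: fun_eq_iff p(1) eval_poly_def sum_fun_apply)
  also have "\<dots> \<in> cspan (eval_monom ` {a. Poly_Mapping.keys a \<subseteq> I \<and> total_degree a = d})"
    using p(2) by (intro cfun.span_sum cfun.span_scale cfun.span_base) auto
  finally show "f \<in> cspan (eval_monom ` {a. Poly_Mapping.keys a \<subseteq> I \<and> total_degree a = d})" .
qed

text \<open>
  The \<open>(n + 1)\<^sup>k\<close> monomials \<open>f\<^sub>0\<^bsup>e(0)\<^esup> \<dots> f\<^sub>k\<^bsup>e(k)\<^esup>\<close> of degree \<open>k n\<close> with \<open>e(i) \<le> n\<close> for \<open>i \<ge> 1\<close> are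
  linearly independent in the space of forms of degree \<open>k n d\<close>.
\<close>

lemma alg_independent_on_count:
  assumes I: "finite I" "I \<noteq> {}" and f: "\<And>i. i \<le> k \<Longrightarrow> f i \<in> forms I d"
    and ind: "alg_independent_on Z f k"
  shows "(n + 1) ^ k \<le> (k * n * d + 1) ^ (card I - 1)"
proof -
  let ?B = "{1..k} \<rightarrow>\<^sub>E {..n}"
  \<comment> \<open>The exponent of \<open>f 0\<close> makes the degree of every monomial equal to \<open>k n\<close>.\<close>
  define \<epsilon> where "\<epsilon> a = (\<lambda>i. if i = 0 then k * n - (\<Sum>l=1..k. a l) else if i \<le> k then a i else 0)"
    for a :: "nat \<Rightarrow> nat"
  have finB: "finite ?B" by (intro finite_PiE) auto
  have inj: "inj_on \<epsilon> ?B"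
  proof (rule inj_onI)
    fix a b assume ab: "a \<in> ?B" "b \<in> ?B" "\<epsilon> a = \<epsilon> b"
    have "a i = b i" if "i \<in> {1..k}" for i
      using fun_cong[OF ab(3), of i] that by (simp add: \<epsilon>_def)
    then show "a = b" using ab(1,2) by (intro PiE_ext) auto
  qed
  let ?E = "\<epsilon> ` ?B"
  have E: "(\<Sum>i\<le>k. e i) = k * n \<and> (\<forall>i>k. e i = 0)" if e: "e \<in> ?E" for e
  proof -
    obtain a where a: "a \<in> ?B" "e = \<epsilon> a" using e by blast
    have "(\<Sum>l=1..k. a l) \<le> (\<Sum>l=1..k. n)"
      using a(1) by (intro sum_mono) (auto simp: PiE_iff)
    then have le: "(\<Sum>l=1..k. a l) \<le> k * n" by simp
    have "{..k} = insert 0 {1..k}" by auto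
    then have "(\<Sum>i\<le>k. e i) = e 0 + (\<Sum>i=1..k. e i)" by simp
    also have "(\<Sum>i=1..k. e i) = (\<Sum>i=1..k. a i)"
      by (intro sum.cong) (auto simp: a(2) \<epsilon>_def)
    finally show ?thesis using le by (simp add: a(2) \<epsilon>_def)
  qed
  define M where "M e = (\<lambda>v. \<Prod>i\<le>k. f i v ^ e i)" for e
  have zero: "c e = 0"
    if "\<And>v. (\<Sum>e\<in>?E. c e * M e v) = 0" "e \<in> ?E" for c :: "(nat \<Rightarrow> nat) \<Rightarrow> complex" and e
    using ind[unfolded alg_independent_on_def, rule_format, of ?E "k * n" c e] finB E that
    unfolding M_def by blast
  have finE: "finite ?E" using finB by simp
  have injM: "inj_on M ?E"
  proof (rule inj_onI, rule ccontr)
    fix a b assume ab: "a \<in> ?E" "b \<in> ?E" "M a = M b" "a \<noteq> b"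
    define c :: "(nat \<Rightarrow> nat) \<Rightarrow> complex" where "c e = (if e = a then 1 else if e = b then -1 else 0)" for e
    have "(\<Sum>e\<in>?E. c e * M e v) = 0" for v
    proof -
      have "(\<Sum>e\<in>?E. c e * M e v) = (\<Sum>e\<in>{a, b}. c e * M e v)"
        using ab finE by (intro sum.mono_neutral_right) (auto simp: c_def)
      then show ?thesis using ab(3,4) by (simp add: c_def)
    qed
    from zero[OF this ab(1)] show False by (simp add: c_def)
  qed
  have indep: "cfun.independent (M ` ?E)"
    unfolding cfun.independent_explicit_finite_subsets
  proof (intro allI impI)
    fix S and u :: "(('a \<Rightarrow> complex) \<Rightarrow> complex) \<Rightarrow> complex"
    assume S: "S \<subseteq> M ` ?E" "(\<Sum>g\<in>S. (\<lambda>v. u g * g v)) = 0"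
    define c where "c e = (if M e \<in> S then u (M e) else 0)" for e
    have c0: "(\<Sum>e\<in>?E. c e * M e v) = 0" for v
    proof -
      have "(\<Sum>e\<in>?E. c e * M e v) = (\<Sum>g\<in>M ` ?E. (if g \<in> S then u g else 0) * g v)"
        unfolding sum.reindex[OF injM] by (simp add: c_def)
      also have "\<dots> = (\<Sum>g\<in>S. u g * g v)"
        using S(1) finE by (intro sum.mono_neutral_cong_right) auto
      also have "\<dots> = 0" using fun_cong[OF S(2), of v] by (simp add: sum_fun_apply)
      finally show ?thesis .
    qed
    have "u (M e) = 0" if "e \<in> ?E" "M e \<in> S" for e
      using zero[of c, OF c0 that(1)] that(2) by (simp add: c_def)
    then show "\<forall>g\<in>S. u g = 0" using S(1) by blast
  qed
  have span: "M ` ?E \<subseteq> cspan (eval_monom ` {a. Poly_Mapping.keys a \<subseteq> I \<and> total_degree a = k * n * d})"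
  proof -
    have "M e \<in> forms I (k * n * d)" if "e \<in> ?E" for e
      using forms_monomial[of "{..k}" f I d e] f E[OF that] unfolding M_def by simp
    then show ?thesis
      by (intro image_subsetI subsetD[OF forms_subset_span]) auto
  qed
  let ?A = "{a. Poly_Mapping.keys a \<subseteq> I \<and> total_degree a = k * n * d}"
  have A: "finite ?A" "card ?A \<le> (k * n * d + 1) ^ (card I - 1)"
    using card_exponents[OF I, of "k * n * d"] by simp_all
  have "card (M ` ?E) \<le> card (eval_monom ` ?A :: (('a \<Rightarrow> complex) \<Rightarrow> complex) set)"
    using cfun.independent_span_bound[OF finite_imageI[OF A(1)] indep span] by (rule conjunct2)
  also have "\<dots> \<le> card ?A" by (rule card_image_le[OF A(1)])
  also have "\<dots> \<le> (k * n * d + 1) ^ (card I - 1)" by (rule A(2))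
  also have "card (M ` ?E) = (n + 1) ^ k"
    using card_image[OF injM] card_image[OF inj] by (simp add: card_PiE)
  finally show ?thesis .
qed

lemma krull_dim_proj_space_le:
  assumes I: "finite I" "I \<noteq> {}"
  shows "krull_dim (zariski I) \<le> enat (card I - 1)"
proof (rule krull_dim_le, rule ccontr)
  fix k and Z :: "nat \<Rightarrow> ('a \<Rightarrow> complex) set set"
  assume "\<And>i. i \<le> k \<Longrightarrow> closedin (zariski I) (Z i)"
    "\<And>i. i \<le> k \<Longrightarrow> irreducible_space (subtopology (zariski I) (Z i))"
    "\<And>i. i < k \<Longrightarrow> Z i \<subset> Z (Suc i)"
  then obtain f d where f: "\<And>i. i \<le> k \<Longrightarrow> f i \<in> forms I d" "alg_independent_on (Z k) f k"
    using chain_alg_independent by blast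
  let ?N = "card I - 1"
  assume "\<not> k \<le> ?N"
  then have k: "Suc ?N \<le> k" by simp
  \<comment> \<open>This gives \<open>((k d + 1) (n + 1))\<^sup>N = n (n + 1)\<^sup>N\<close>, which is less than \<open>(n + 1)\<^bsup>N+1\<^esup>\<close>.\<close>
  define n where "n = (k * d + 1) ^ ?N"
  have "(n + 1) ^ Suc ?N \<le> (n + 1) ^ k" using k by (intro power_increasing) auto
  also have "\<dots> \<le> (k * n * d + 1) ^ ?N" using alg_independent_on_count[OF I f] .
  also have "\<dots> \<le> ((k * d + 1) * (n + 1)) ^ ?N"
    by (intro power_mono) (auto simp: algebra_simps)
  also have "\<dots> = n * (n + 1) ^ ?N" by (simp only: power_mult_distrib n_def[symmetric])
  finally show False by simp
qed

section \<open>Quadrics and cyclic shifts\<close>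

text \<open>
  Symmetric bilinear forms on a space of functions; these play the role of quadrics, with
  \<open>Q y y = 0\<close> saying that the quadric passes through \<open>y\<close>, and \<open>Q y _ = 0\<close> that it is singular at \<open>y\<close>.
\<close>

definition sym_bilinear :: "(('a \<Rightarrow> complex) \<Rightarrow> ('a \<Rightarrow> complex) \<Rightarrow> complex) \<Rightarrow> bool" where
  "sym_bilinear Q \<longleftrightarrow> (\<forall>u v. Q u v = Q v u) \<and>
     (\<forall>u v w. Q (\<lambda>i. u i + v i) w = Q u w + Q v w) \<and> (\<forall>c u w. Q (\<lambda>i. c * u i) w = c * Q u w)"

lemma sym_bilinearD:
  assumes "sym_bilinear Q"
  shows "Q u v = Q v u" "Q (\<lambda>i. u i + v i) w = Q u w + Q v w" "Q (\<lambda>i. c * u i) w = c * Q u w"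
    "Q w (\<lambda>i. u i + v i) = Q w u + Q w v" "Q w (\<lambda>i. c * u i) = c * Q w u"
    "Q (\<lambda>i. 0) w = 0" "Q w (\<lambda>i. 0) = 0"
proof -
  show *: "Q u v = Q v u" "Q (\<lambda>i. u i + v i) w = Q u w + Q v w" "Q (\<lambda>i. c * u i) w = c * Q u w"
    for u v w c
    using assms unfolding sym_bilinear_def by blast+
  show "Q w (\<lambda>i. u i + v i) = Q w u + Q w v" "Q w (\<lambda>i. c * u i) = c * Q w u"
    by (simp_all only: *(1)[of w] *(2,3))
  show "Q (\<lambda>i. 0) w = 0" "Q w (\<lambda>i. 0) = 0"
    using *(3)[of 0 "\<lambda>i. 0" w] by (simp_all add: *(1)[of w])
qed

lemma sym_bilinear_sum:
  assumes "\<And>i. i \<in> A \<Longrightarrow> sym_bilinear (Q i)"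
  shows "sym_bilinear (\<lambda>u v. \<Sum>i\<in>A. x i * Q i u v)"
  unfolding sym_bilinear_def
proof (intro conjI allI)
  show "(\<Sum>i\<in>A. x i * Q i u v) = (\<Sum>i\<in>A. x i * Q i v u)" for u v
    using sym_bilinearD(1)[OF assms] by (intro sum.cong) auto
  show "(\<Sum>i\<in>A. x i * Q i (\<lambda>i. u i + v i) w) = (\<Sum>i\<in>A. x i * Q i u w) + (\<Sum>i\<in>A. x i * Q i v w)"
    for u v w
    unfolding sum.distrib[symmetric]
    using sym_bilinearD(2)[OF assms] by (intro sum.cong) (auto simp: algebra_simps)
  show "(\<Sum>i\<in>A. x i * Q i (\<lambda>i. c * u i) w) = c * (\<Sum>i\<in>A. x i * Q i u w)"
    for c u w
    unfolding sum_distrib_left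
    using sym_bilinearD(3)[OF assms] by (intro sum.cong) (auto simp: algebra_simps)
qed

lemma poly_eq_zero_of_card_roots:
  fixes q :: "complex poly"
  assumes "\<And>z. z \<in> L \<Longrightarrow> poly q z = 0" "degree q < card L"
  shows "q = 0"
proof (rule ccontr)
  assume "q \<noteq> 0"
  then have "card L \<le> card {z. poly q z = 0}"
    using assms(1) poly_roots_finite by (intro card_mono) auto
  then show False
    using card_poly_roots_bound[OF \<open>q \<noteq> 0\<close>] assms(2) by simp
qed

text \<open>
  Take a quadric through the points \<open>y z\<close>, \<open>z \<in> L\<close>, of the curve \<open>f1 + z f2 + z\<^sup>2 g0 + z\<^sup>3 g1\<close> that is
  singular at \<open>y z0\<close> and vanishes on the span of \<open>g0, g1\<close>.  Being singular at \<open>y z0\<close>, it vanishes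
  on \<open>y z - y z0\<close> for \<open>z \<in> L\<close>; dividing by \<open>(z - z0)\<^sup>2\<close> leaves a polynomial in \<open>z\<close> of degree at most \<open>2\<close>,
  and at most \<open>1\<close> or \<open>0\<close> when \<open>g1\<close> or both \<open>g0\<close> and \<open>g1\<close> are zero, so it vanishes if \<open>L\<close> is large enough.
\<close>

lemma quadric_singular_at_moment_point:
  fixes f1 f2 g0 g1 :: "'a \<Rightarrow> complex" and L :: "complex set"
  defines "y \<equiv> \<lambda>z i. f1 i + z * f2 i + z ^ 2 * g0 i + z ^ 3 * g1 i"
  assumes Q: "sym_bilinear Q" and z0: "z0 \<in> L"
    and sing: "\<And>w. w \<in> {f1, f2, g0, g1} \<Longrightarrow> Q (y z0) w = 0"
    and van: "\<And>z. z \<in> L \<Longrightarrow> Q (y z) (y z) = 0"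
    and base: "Q g0 g0 = 0" "Q g0 g1 = 0" "Q g1 g1 = 0"
    and card: "card L \<ge> 4 \<or> (card L \<ge> 3 \<and> g1 = (\<lambda>i. 0)) \<or> (card L \<ge> 2 \<and> g0 = (\<lambda>i. 0) \<and> g1 = (\<lambda>i. 0))"
    and uv: "u \<in> {f1, f2}" "v \<in> {f1, f2, g0, g1}"
  shows "Q u v = 0"
proof -
  note bil = sym_bilinearD[OF Q]
  define A B C D0 D1 E0 E1 where "A = Q f1 f1" and "B = Q f1 f2" and "C = Q f2 f2"
    and "D0 = Q f1 g0" and "D1 = Q f1 g1" and "E0 = Q f2 g0" and "E1 = Q f2 g1"
  note defs = A_def B_def C_def D0_def D1_def E0_def E1_def
  have left: "Q (y z) w = Q f1 w + z * Q f2 w + z ^ 2 * Q g0 w + z ^ 3 * Q g1 w" for z w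
    unfolding y_def by (simp only: bil(2,3))
  have right: "Q w (y z) = Q f1 w + z * Q f2 w + z ^ 2 * Q g0 w + z ^ 3 * Q g1 w" for z w
    using left[of z w] bil(1)[of w "y z"] by simp
  have sw: "Q f2 f1 = B" "Q g0 f1 = D0" "Q g1 f1 = D1" "Q g0 f2 = E0" "Q g1 f2 = E1" "Q g1 g0 = 0"
    using bil(1)[of f1 f2] bil(1)[of f1 g0] bil(1)[of f1 g1] bil(1)[of f2 g0] bil(1)[of f2 g1]
      bil(1)[of g0 g1] base(2) by (simp_all add: defs)
  have s: "A + z0 * B + z0 ^ 2 * D0 + z0 ^ 3 * D1 = 0" "B + z0 * C + z0 ^ 2 * E0 + z0 ^ 3 * E1 = 0"
    "D0 + z0 * E0 = 0" "D1 + z0 * E1 = 0"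
    using sing[of f1] sing[of f2] sing[of g0] sing[of g1]
    by (simp_all add: left sw base flip: defs)
  have D: "D0 = - z0 * E0" "D1 = - z0 * E1" using s(3,4) by algebra+
  have Beq: "B = - z0 * C - z0 ^ 2 * E0 - z0 ^ 3 * E1" using s(2) by algebra
  have Aeq: "A = z0 ^ 2 * C + 2 * z0 ^ 3 * E0 + 2 * z0 ^ 4 * E1"
    using s(1) unfolding D Beq by algebra
  \<comment> \<open>By the relations above, \<open>Q (y z) (y z) = (z - z0)\<^sup>2 q(z)\<close>.\<close>
  define q where "q = [:C + 2 * z0 * E0 + 2 * z0 ^ 2 * E1, 2 * E0 + 2 * z0 * E1, 2 * E1:]"
  have root: "poly q z = 0" if "z \<in> L - {z0}" for z
  proof -
    have "Q (y z) (y z) = A + 2 * z * B + z ^ 2 * C + 2 * z ^ 2 * D0 + 2 * z ^ 3 * D1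
        + 2 * z ^ 3 * E0 + 2 * z ^ 4 * E1"
      unfolding left by (simp add: right base sw flip: defs) algebra
    then have "A + 2 * z * B + z ^ 2 * C + 2 * z ^ 2 * D0 + 2 * z ^ 3 * D1
        + 2 * z ^ 3 * E0 + 2 * z ^ 4 * E1 = 0"
      using van that by auto
    then have "(z - z0) ^ 2 * poly q z = 0"
      unfolding Aeq Beq D q_def by simp algebra
    then show ?thesis using that by simp
  qed
  have fin: "finite L" using card by (auto intro: card_ge_0_finite)
  have cL: "card (L - {z0}) = card L - 1"
    using z0 fin by simp
  have g: "g0 = (\<lambda>i. 0) \<Longrightarrow> E0 = 0" "g1 = (\<lambda>i. 0) \<Longrightarrow> E1 = 0"
    by (simp_all add: defs bil)
  have "degree q < card (L - {z0})"
    using card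
  proof (elim disjE conjE)
    assume "card L \<ge> 4"
    moreover have "degree q \<le> 2" unfolding q_def by (simp add: numeral_2_eq_2)
    ultimately show ?thesis using cL by simp
  next
    assume "card L \<ge> 3" "g1 = (\<lambda>i. 0)"
    moreover from g(2)[OF this(2)] have "degree q \<le> 1" unfolding q_def by simp
    ultimately show ?thesis using cL by simp
  next
    assume "card L \<ge> 2" "g0 = (\<lambda>i. 0)" "g1 = (\<lambda>i. 0)"
    moreover from g(1)[OF this(2)] g(2)[OF this(3)] have "degree q \<le> 0" unfolding q_def by simp
    ultimately show ?thesis using cL by simp
  qed
  with root have "q = 0" by (rule poly_eq_zero_of_card_roots)
  then have "E1 = 0" "E0 = 0" "C = 0"
    unfolding q_def by auto
  moreover from this have "A = 0" "B = 0" "D0 = 0" "D1 = 0"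
    using Aeq Beq D by simp_all
  ultimately show ?thesis
    using uv sw by (auto simp flip: defs)
qed

lemma coeffs_zero_of_roots_of_unity:
  fixes a :: "nat \<Rightarrow> complex"
  assumes "\<And>z. z ^ Suc m = 1 \<Longrightarrow> (\<Sum>i\<le>m. a i * z ^ i) = 0" and "i \<le> m"
  shows "a i = 0"
proof -
  define q where "q = (\<Sum>i\<le>m. monom (a i) i)"
  have "q = 0"
  proof (rule poly_eq_zero_of_card_roots)
    show "poly q z = 0" if "z \<in> {z. z ^ Suc m = 1}" for z
      using assms(1)[of z] that by (simp add: q_def poly_sum poly_monom)
    have "degree q \<le> m"
      unfolding q_def by (intro degree_sum_le) (auto intro: order_trans[OF degree_monom_le])
    then show "degree q < card {z :: complex. z ^ Suc m = 1}"
      using card_nth_roots[of 1 "Suc m"] by simp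
  qed
  moreover have "coeff q i = a i"
    using assms(2) by (simp add: q_def coeff_sum)
  ultimately show ?thesis by simp
qed

text \<open>
  The predecessor in the cyclic order \<open>0, 1, \<dots>, m\<close>.
\<close>

definition cyc_pred :: "nat \<Rightarrow> nat \<Rightarrow> nat" where
  "cyc_pred m i = (if i = 0 then m else i - 1)"

lemma cyc_pred_le: "i \<le> m \<Longrightarrow> cyc_pred m i \<le> m"
  by (auto simp: cyc_pred_def)

lemma cyc_pred_surj: "k \<le> m \<Longrightarrow> \<exists>i\<le>m. cyc_pred m i = k"
  by (cases "k = m") (force simp: cyc_pred_def intro: exI[of _ 0] exI[of _ "Suc k"])+

text \<open>
  If two linear functionals \<open>\<theta>1\<close>, \<open>\<theta>2\<close> on \<open>\<complex>\<^bsup>m+1\<^esup>\<close> satisfy \<open>\<theta>1 x + z \<theta>2 x = 0\<close> on the vectors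
  \<open>x = (c\<^sub>i z\<^sup>i)\<^sub>i\<close> with \<open>z\<^bsup>m+1\<^esup> = 1\<close>, then \<open>\<theta>1 = - \<theta>2 \<circ> D\<close> for the operator \<open>D\<close> with eigenvectors
  \<open>x\<close> and eigenvalues \<open>z\<close>.  This operator maps \<open>e\<^sub>i\<close> to \<open>c\<^bsub>i-1\<^esub> / c\<^sub>i\<close> times \<open>e\<^bsub>i-1\<^esub>\<close>, with indices modulo
  \<open>m + 1\<close>, and the lemma states the identity on \<open>e\<^sub>i\<close> without denominators.
\<close>

lemma cyclic_relation:
  fixes c \<theta>1 \<theta>2 :: "nat \<Rightarrow> complex"
  assumes rel: "\<And>z. z ^ Suc m = 1 \<Longrightarrow> (\<Sum>i\<le>m. c i * z ^ i * (\<theta>1 i + z * \<theta>2 i)) = 0"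
    and "i \<le> m"
  shows "c i * \<theta>1 i + c (cyc_pred m i) * \<theta>2 (cyc_pred m i) = 0"
  using _ \<open>i \<le> m\<close>
proof (rule coeffs_zero_of_roots_of_unity)
  fix z :: complex assume z: "z ^ Suc m = 1"
  have "(\<Sum>i\<le>m. c i * \<theta>2 i * z ^ Suc i) = (\<Sum>i\<le>m. c (cyc_pred m i) * \<theta>2 (cyc_pred m i) * z ^ i)"
  proof (cases m)
    case 0
    then show ?thesis using z by (simp add: cyc_pred_def)
  next
    case (Suc k)
    have "(\<Sum>i\<le>m. c i * \<theta>2 i * z ^ Suc i) = (\<Sum>i\<le>k. c i * \<theta>2 i * z ^ Suc i) + c m * \<theta>2 m"
      using z by (simp add: Suc)
    also have "\<dots> = (\<Sum>i\<le>m. c (cyc_pred m i) * \<theta>2 (cyc_pred m i) * z ^ i)"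
      unfolding Suc sum.atMost_Suc_shift by (simp add: cyc_pred_def)
    finally show ?thesis .
  qed
  then have "(\<Sum>i\<le>m. (c i * \<theta>1 i + c (cyc_pred m i) * \<theta>2 (cyc_pred m i)) * z ^ i) =
      (\<Sum>i\<le>m. c i * z ^ i * (\<theta>1 i + z * \<theta>2 i))"
    by (simp add: algebra_simps sum.distrib)
  then show "(\<Sum>i\<le>m. (c i * \<theta>1 i + c (cyc_pred m i) * \<theta>2 (cyc_pred m i)) * z ^ i) = 0"
    using rel[OF z] by simp
qed

lemma power_mult_swap_neq:
  fixes s t e f :: nat
  assumes "s > 0" "t > 0" "s \<noteq> t" "e \<noteq> f"
  shows "s ^ e * t ^ f \<noteq> t ^ e * s ^ f"
proof -
  have *: "a ^ e * b ^ f \<noteq> b ^ e * a ^ f" if "a > 0" "b > 0" "a \<noteq> b" "e < f" for a b e f :: nat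
  proof
    assume "a ^ e * b ^ f = b ^ e * a ^ f"
    moreover obtain d where d: "f = e + d" "d > 0" using \<open>e < f\<close> less_imp_add_positive by blast
    ultimately have "b ^ d = a ^ d" using that by (simp add: power_add)
    then show False using d(2) \<open>a \<noteq> b\<close> power_eq_iff_eq_base[of d b a] by simp
  qed
  show ?thesis
    using *[of s t e f] *[of t s f e] assms by (metis mult.commute nat_neq_iff)
qed

text \<open>
  A \<open>2 \<times> 2\<close> matrix of functionals \<open>\<theta> a b\<close> on \<open>\<complex>\<^bsup>m+1\<^esup>\<close> whose rows are related by the weighted shift
  \<open>D\<^sub>s\<close> and whose columns are related by \<open>D\<^sub>t\<close> is zero.  Computing \<open>\<theta> 0 0\<close> from \<open>\<theta> 1 1\<close> in two ways gives
  \<open>\<theta> 1 1 \<circ> (D\<^sub>s D\<^sub>t - D\<^sub>t D\<^sub>s) = 0\<close>.  With \<open>c\<^sub>i = s\<^bsup>i*i\<^esup>\<close> the commutator is invertible: its entries vanish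
  only if \<open>(s / t)\<close> to the power \<open>2 j\<^sup>2 - i\<^sup>2 - k\<^sup>2\<close> is \<open>1\<close> for cyclically consecutive \<open>k, j, i\<close>,
  and that exponent is never zero.
\<close>

lemma cyclic_commutator:
  fixes s t :: nat and \<theta> :: "nat \<Rightarrow> nat \<Rightarrow> nat \<Rightarrow> complex"
  defines "c \<equiv> \<lambda>s i. complex_of_nat s ^ (i * i)"
  assumes m: "m \<ge> 1" and st: "s > 0" "t > 0" "s \<noteq> t"
    and rs: "\<And>b i. b < 2 \<Longrightarrow> i \<le> m \<Longrightarrow>
      c s i * \<theta> 0 b i + c s (cyc_pred m i) * \<theta> 1 b (cyc_pred m i) = 0"
    and rt: "\<And>a i. a < 2 \<Longrightarrow> i \<le> m \<Longrightarrow>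
      c t i * \<theta> a 0 i + c t (cyc_pred m i) * \<theta> a 1 (cyc_pred m i) = 0"
    and ab: "a < 2" "b < 2" "i \<le> m"
  shows "\<theta> a b i = 0"
proof -
  have cnz: "c s i \<noteq> 0" "c t i \<noteq> 0" for i using st by (simp_all add: c_def)
  have t11: "\<theta> 1 1 k = 0" if "k \<le> m" for k
  proof -
    obtain j where j: "j \<le> m" "cyc_pred m j = k" using cyc_pred_surj \<open>k \<le> m\<close> by blast
    obtain i where i: "i \<le> m" "cyc_pred m i = j" using cyc_pred_surj j(1) by blast
    have 1: "c s i * \<theta> 0 0 i = - (c s j * \<theta> 1 0 j)" "c t j * \<theta> 1 0 j = - (c t k * \<theta> 1 1 k)"
      "c t i * \<theta> 0 0 i = - (c t j * \<theta> 0 1 j)" "c s j * \<theta> 0 1 j = - (c s k * \<theta> 1 1 k)"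
      using rs[of 0 i] rs[of 1 j] rt[of 0 i] rt[of 1 j] i j by (simp_all add: eq_neg_iff_add_eq_0)
    then have "(c s j * c s j * (c t i * c t k) - c t j * c t j * (c s i * c s k)) * \<theta> 1 1 k = 0"
      by algebra
    moreover have "c s j * c s j * (c t i * c t k) - c t j * c t j * (c s i * c s k) \<noteq> 0"
    proof -
      have "2 * (j * j) \<noteq> i * i + k * k"
      proof (cases "i = 0")
        case True
        then have "j = m" "k = m - 1" using i j m by (auto simp: cyc_pred_def)
        moreover have "(m - 1) * (m - 1) \<le> m * m" by (intro mult_mono) auto
        moreover have "m * m > 0" using m by simp
        ultimately have "2 * (m * m) > (m - 1) * (m - 1)" by linarith
        then show ?thesis using True \<open>j = m\<close> \<open>k = m - 1\<close> by simp
      next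
        case False
        then have ij: "i = Suc j" using i by (auto simp: cyc_pred_def)
        show ?thesis
        proof (cases "j = 0")
          case True
          then show ?thesis using ij by simp
        next
          case False
          then have "j = Suc k" using j by (auto simp: cyc_pred_def)
          then show ?thesis using ij by (simp add: algebra_simps)
        qed
      qed
      then have "s ^ (2 * (j * j)) * t ^ (i * i + k * k) \<noteq> t ^ (2 * (j * j)) * s ^ (i * i + k * k)"
        using power_mult_swap_neq[OF st] by blast
      then have "complex_of_nat (s ^ (2 * (j * j)) * t ^ (i * i + k * k)) \<noteq>
          complex_of_nat (t ^ (2 * (j * j)) * s ^ (i * i + k * k))"
        unfolding of_nat_eq_iff .
      then show ?thesis
        unfolding c_def by (simp add: power_add mult_2)
    qed
    ultimately show ?thesis by simp
  qed
  have t10: "\<theta> 1 0 k = 0" if "k \<le> m" for k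
    using rt[of 1 k] that t11 cyc_pred_le[OF that] cnz by simp
  have t01: "\<theta> 0 1 k = 0" if "k \<le> m" for k
    using rs[of 1 k] that t11 cyc_pred_le[OF that] cnz by simp
  have t00: "\<theta> 0 0 k = 0" if "k \<le> m" for k
    using rs[of 0 k] that t10 cyc_pred_le[OF that] cnz by simp
  have "a = 0 \<or> a = 1" "b = 0 \<or> b = 1" using ab by auto
  then show ?thesis using t00 t01 t10 t11 ab(3) by auto
qed

section \<open>Configurations of points\<close>

text \<open>
  The dual form of the condition that the tangent spaces to the affine cone over the Segre-Veronese
  variety at the points \<open>(x, y)\<close> of \<open>P\<close> span the whole space.  A linear functional on the ambient
  space is a family \<open>Q 0, \<dots>, Q m\<close> of symmetric bilinear forms, and it kills the tangent space at
  \<open>(x, y)\<close> if and only if all \<open>Q i y y\<close> and all \<open>\<Sum>i. x\<^sub>i Q i y e\<^sub>l\<close> vanish.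
\<close>

definition spanning_configuration ::
  "nat \<Rightarrow> nat \<Rightarrow> ((nat \<Rightarrow> complex) \<times> (nat \<Rightarrow> complex)) set \<Rightarrow> bool" where
  "spanning_configuration m n P \<longleftrightarrow>
     (\<forall>Q. (\<forall>i\<le>m. sym_bilinear (Q i)) \<longrightarrow>
       (\<forall>(x, y)\<in>P. (\<forall>i\<le>m. Q i y y = 0) \<and> (\<forall>l\<le>n. (\<Sum>i\<le>m. x i * Q i y (unit_vec l)) = 0)) \<longrightarrow>
       (\<forall>i\<le>m. \<forall>j\<le>n. \<forall>k\<le>n. Q i (unit_vec j) (unit_vec k) = 0))"

text \<open>
  The coordinates \<open>2 K, \<dots>, 2 K + r - 1\<close> span the base.  For \<open>r < 2\<close> the missing basis vectors are
  replaced by \<open>0\<close>, so that the cases \<open>r = 0, 1, 2\<close> can be treated together.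
\<close>

definition base_vec0 :: "nat \<Rightarrow> nat \<Rightarrow> nat \<Rightarrow> complex" where
  "base_vec0 r K = (if r \<ge> 1 then unit_vec (2 * K) else (\<lambda>l. 0))"

definition base_vec1 :: "nat \<Rightarrow> nat \<Rightarrow> nat \<Rightarrow> complex" where
  "base_vec1 r K = (if r \<ge> 2 then unit_vec (2 * K + 1) else (\<lambda>l. 0))"

text \<open>
  Points with \<open>y\<close> in the base, one for \<open>r = 1\<close> and three for \<open>r = 2\<close>; no quadratic form on the base
  other than zero vanishes at all of them.  The vector \<open>x\<close> is irrelevant for this.
\<close>

definition base_points :: "nat \<Rightarrow> nat \<Rightarrow> ((nat \<Rightarrow> complex) \<times> (nat \<Rightarrow> complex)) set" where
  "base_points r K =
     (if r \<ge> 1 then {(unit_vec 0, base_vec0 r K)} else {}) \<union>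
     (if r \<ge> 2 then {(unit_vec 0, base_vec1 r K),
        (unit_vec 0, (\<lambda>l. base_vec0 r K l + base_vec1 r K l))} else {})"

text \<open>
  The points belonging to the plane \<open>B\<^sub>p\<close> spanned by the coordinates \<open>2 p\<close> and \<open>2 p + 1\<close>, for \<open>z\<close> with
  \<open>z\<^bsup>m+1\<^esup> = 1\<close>.  The weights in \<open>block_x\<close> depend on \<open>p\<close> through the positive number \<open>p + 1\<close>, so that
  the shifts of different planes have an invertible commutator.
\<close>

definition block_x :: "nat \<Rightarrow> nat \<Rightarrow> complex \<Rightarrow> nat \<Rightarrow> complex" where
  "block_x m p z = (\<lambda>i. if i \<le> m then of_nat (Suc p) ^ (i * i) * z ^ i else 0)"

definition block_y :: "nat \<Rightarrow> nat \<Rightarrow> nat \<Rightarrow> complex \<Rightarrow> nat \<Rightarrow> complex" where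
  "block_y r K p z = (\<lambda>l. unit_vec (2 * p) l + z * unit_vec (2 * p + 1) l
      + z ^ 2 * base_vec0 r K l + z ^ 3 * base_vec1 r K l)"

text \<open>
  The points of the base together with \<open>m + 1\<close> points for each of the \<open>K\<close> planes.
\<close>

definition configuration ::
  "nat \<Rightarrow> nat \<Rightarrow> nat \<Rightarrow> ((nat \<Rightarrow> complex) \<times> (nat \<Rightarrow> complex)) set" where
  "configuration m r K = base_points r K \<union>
     (\<lambda>(p, z). (block_x m p z, block_y r K p z)) ` ({..<K} \<times> {z. z ^ Suc m = 1})"

text \<open>
  The condition \<open>r \<le> m - 1\<close> provides the \<open>r + 2\<close> points per plane that the quadric argument needs.
\<close>

lemma configuration_spanning:
  assumes m: "m \<ge> 1" and r: "r \<le> 2" "r \<le> m - 1" and n: "n + 1 = 2 * K + r"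
  shows "spanning_configuration m n (configuration m r K)"
  unfolding spanning_configuration_def
proof (intro allI impI)
  fix Q :: "nat \<Rightarrow> (nat \<Rightarrow> complex) \<Rightarrow> (nat \<Rightarrow> complex) \<Rightarrow> complex" and i j k :: nat
  assume Q': "\<forall>i\<le>m. sym_bilinear (Q i)"
    and P: "\<forall>(x, y)\<in>configuration m r K.
      (\<forall>i\<le>m. Q i y y = 0) \<and> (\<forall>l\<le>n. (\<Sum>i\<le>m. x i * Q i y (unit_vec l)) = 0)"
    and ijk: "i \<le> m" "j \<le> n" "k \<le> n"
  have Q: "sym_bilinear (Q i)" if "i \<le> m" for i using Q' that by blast
  let ?g0 = "base_vec0 r K" and ?g1 = "base_vec1 r K"
  let ?L = "{z :: complex. z ^ Suc m = 1}"
  have cardL: "card ?L = Suc m" using card_nth_roots[of 1 "Suc m"] by simp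
  have base_pt: "Q i y y = 0" if "i \<le> m" "(x, y) \<in> base_points r K" for x y i
    using P that by (auto simp: configuration_def)
  have block_pt: "Q i (block_y r K p z) (block_y r K p z) = 0"
    "l \<le> n \<Longrightarrow> (\<Sum>i\<le>m. block_x m p z i * Q i (block_y r K p z) (unit_vec l)) = 0"
    if "i \<le> m" "p < K" "z \<in> ?L" for i p z l
  proof -
    have "(block_x m p z, block_y r K p z) \<in> configuration m r K"
      using that by (auto simp: configuration_def)
    then show "Q i (block_y r K p z) (block_y r K p z) = 0"
      "l \<le> n \<Longrightarrow> (\<Sum>i\<le>m. block_x m p z i * Q i (block_y r K p z) (unit_vec l)) = 0"
      using P that(1) by blast+
  qed
  have base: "Q i ?g0 ?g0 = 0 \<and> Q i ?g1 ?g1 = 0 \<and> Q i ?g0 ?g1 = 0" if "i \<le> m" for i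
  proof -
    note bil = sym_bilinearD[OF Q[OF that]]
    have 0: "Q i ?g0 ?g0 = 0"
      using base_pt[OF that, of "unit_vec 0" ?g0]
      by (cases "r \<ge> 1") (auto simp: base_points_def base_vec0_def bil)
    have 1: "Q i ?g1 ?g1 = 0"
      using base_pt[OF that, of "unit_vec 0" ?g1]
      by (cases "r \<ge> 2") (auto simp: base_points_def base_vec1_def bil)
    have "Q i ?g0 ?g1 = 0"
    proof (cases "r \<ge> 2")
      case True
      then have "Q i (\<lambda>l. ?g0 l + ?g1 l) (\<lambda>l. ?g0 l + ?g1 l) = 0"
        by (intro base_pt[OF that, of "unit_vec 0"]) (auto simp: base_points_def)
      then show ?thesis
        using 0 1 bil(1)[of ?g0 ?g1] by (simp add: bil(2,4))
    next
      case False
      then show ?thesis by (simp add: base_vec1_def bil)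
    qed
    then show ?thesis using 0 1 by blast
  qed
  \<comment> \<open>Pairings of one plane with itself and with the base vanish, since the vectors \<open>x\<close> of a plane form a basis.\<close>
  have block: "Q i u v = 0"
    if i: "i \<le> m" and p: "p < K" and u: "u \<in> {unit_vec (2 * p), unit_vec (2 * p + 1)}"
      and v: "v \<in> {unit_vec (2 * p), unit_vec (2 * p + 1), ?g0, ?g1}" for i p u v
  proof -
    have "of_nat (Suc p) ^ (i * i) * Q i u v = 0"
    proof (rule coeffs_zero_of_roots_of_unity[OF _ i])
      fix z :: complex assume z: "z ^ Suc m = 1"
      define R where "R = (\<lambda>u v. \<Sum>i\<le>m. block_x m p z i * Q i u v)"
      have R: "sym_bilinear R"
        unfolding R_def using Q by (intro sym_bilinear_sum) auto
      have "R u v = 0"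
      proof (rule quadric_singular_at_moment_point[OF R, of z ?L])
        show "z \<in> ?L" using z by simp
        show "R (\<lambda>i. unit_vec (2 * p) i + z * unit_vec (2 * p + 1) i + z\<^sup>2 * ?g0 i + z ^ 3 * ?g1 i) w = 0"
          if "w \<in> {unit_vec (2 * p), unit_vec (2 * p + 1), ?g0, ?g1}" for w
        proof -
          have "w = (\<lambda>l. 0) \<or> (\<exists>l\<le>n. w = unit_vec l)"
            using that n p unfolding base_vec0_def base_vec1_def
            by (auto split: if_splits intro: exI[of _ "2 * p"] exI[of _ "Suc (2 * p)"]
                exI[of _ "2 * K"] exI[of _ "Suc (2 * K)"])
          then show ?thesis
            using block_pt(2)[OF i p, of z] z sym_bilinearD(7)[OF R]
            unfolding R_def block_y_def by auto
        qed
        show "R (\<lambda>i. unit_vec (2 * p) i + w * unit_vec (2 * p + 1) i + w\<^sup>2 * ?g0 i + w ^ 3 * ?g1 i)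
            (\<lambda>i. unit_vec (2 * p) i + w * unit_vec (2 * p + 1) i + w\<^sup>2 * ?g0 i + w ^ 3 * ?g1 i) = 0"
          if "w \<in> ?L" for w
          using block_pt(1)[OF _ p that] unfolding R_def block_y_def by simp
        show "R ?g0 ?g0 = 0" "R ?g0 ?g1 = 0" "R ?g1 ?g1 = 0"
          unfolding R_def using base by simp_all
        show "card ?L \<ge> 4 \<or> (card ?L \<ge> 3 \<and> ?g1 = (\<lambda>i. 0)) \<or>
            (card ?L \<ge> 2 \<and> ?g0 = (\<lambda>i. 0) \<and> ?g1 = (\<lambda>i. 0))"
        proof -
          consider "r = 0" | "r = 1" "Suc m \<ge> 3" | "r = 2" "Suc m \<ge> 4"
            using r by linarith
          then show ?thesis
            unfolding cardL using m by cases (auto simp: base_vec0_def base_vec1_def)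
        qed
      qed (use u v in auto)
      then show "(\<Sum>i\<le>m. of_nat (Suc p) ^ (i * i) * Q i u v * z ^ i) = 0"
        unfolding R_def block_x_def by (simp add: mult_ac)
    qed
    then show ?thesis by (metis mult_eq_0_iff of_nat_neq_0 power_not_zero)
  qed
  \<comment> \<open>Pairs of distinct planes; the base components of \<open>y\<close> contribute nothing by the previous step.\<close>
  have cross: "Q i (unit_vec (2 * p + a)) (unit_vec (2 * q + b)) = 0"
    if pq: "p < K" "q < K" "p \<noteq> q" and ab: "a < 2" "b < 2" and i: "i \<le> m" for p q a b i
  proof -
    define \<theta> where "\<theta> a b i = Q i (unit_vec (2 * p + a)) (unit_vec (2 * q + b))" for a b i
    have rel: "of_nat (Suc p) ^ (i * i) * Q i (unit_vec (2 * p)) (unit_vec (2 * q + b)) +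
        of_nat (Suc p) ^ (cyc_pred m i * cyc_pred m i) *
          Q (cyc_pred m i) (unit_vec (2 * p + 1)) (unit_vec (2 * q + b)) = 0"
      if pq: "p < K" "q < K" and b: "b < 2" and i: "i \<le> m" for p q b i
    proof (rule cyclic_relation[OF _ i, where c = "\<lambda>i. of_nat (Suc p) ^ (i * i)"])
      fix z :: complex assume z: "z ^ Suc m = 1"
      let ?w = "unit_vec (2 * q + b) :: nat \<Rightarrow> complex"
      have base_q: "Q i ?g0 ?w = 0" "Q i ?g1 ?w = 0" if "i \<le> m" for i
      proof -
        have "b = 0 \<or> b = 1" using b by auto
        then have "Q i ?w ?g0 = 0" "Q i ?w ?g1 = 0"
          using block[OF that pq(2), of ?w] by auto
        then show "Q i ?g0 ?w = 0" "Q i ?g1 ?w = 0"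
          using sym_bilinearD(1)[OF Q[OF that]] by metis+
      qed
      have "2 * q + b \<le> n" using pq b n by auto
      then have "(\<Sum>i\<le>m. block_x m p z i * Q i (block_y r K p z) ?w) = 0"
        using block_pt(2)[OF i pq(1)] z by blast
      moreover have "Q i (block_y r K p z) ?w =
          Q i (unit_vec (2 * p)) ?w + z * Q i (unit_vec (2 * p + 1)) ?w" if "i \<le> m" for i
        unfolding block_y_def sym_bilinearD(2,3)[OF Q[OF that]] base_q[OF that] by simp
      ultimately show "(\<Sum>i\<le>m. of_nat (Suc p) ^ (i * i) * z ^ i *
          (Q i (unit_vec (2 * p)) ?w + z * Q i (unit_vec (2 * p + 1)) ?w)) = 0"
        unfolding block_x_def by simp
    qed
    have "\<theta> a b i = 0"
    proof (rule cyclic_commutator[OF m, of "Suc p" "Suc q"])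
      show "of_nat (Suc p) ^ (i * i) * \<theta> 0 b i +
          of_nat (Suc p) ^ (cyc_pred m i * cyc_pred m i) * \<theta> 1 b (cyc_pred m i) = 0"
        if "b < 2" "i \<le> m" for b i
        using rel[OF pq(1,2) that] by (simp add: \<theta>_def)
      show "of_nat (Suc q) ^ (i * i) * \<theta> a 0 i +
          of_nat (Suc q) ^ (cyc_pred m i * cyc_pred m i) * \<theta> a 1 (cyc_pred m i) = 0"
        if "a < 2" "i \<le> m" for a i
      proof -
        have "\<theta> a c h = Q h (unit_vec (2 * q + c)) (unit_vec (2 * p + a))" if "h \<le> m" for c h
          unfolding \<theta>_def by (rule sym_bilinearD(1)[OF Q[OF that]])
        then show ?thesis
          using rel[OF pq(2,1) that] that(2) cyc_pred_le[OF that(2)] by simp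
      qed
    qed (use pq ab i in auto)
    then show ?thesis by (simp add: \<theta>_def)
  qed
  have index: "(\<exists>p<K. \<exists>a<2. l = 2 * p + a) \<or> (unit_vec l \<in> {?g0, ?g1})" if "l \<le> n" for l
  proof (cases "l < 2 * K")
    case True
    then have "l div 2 < K" "l mod 2 < 2" "l = 2 * (l div 2) + l mod 2" by auto
    then show ?thesis by blast
  next
    case False
    then have "(l = 2 * K \<and> r \<ge> 1) \<or> (l = 2 * K + 1 \<and> r \<ge> 2)"
      using that n r(1) by auto
    then show ?thesis by (auto simp: base_vec0_def base_vec1_def)
  qed
  have sym: "Q i u v = Q i v u" for u v using sym_bilinearD(1)[OF Q[OF ijk(1)]] .
  have two: "a = 0 \<or> a = 1" if "a < 2" for a :: nat using that by auto
  have mixed: "Q i (unit_vec (2 * p + a)) v = 0" if "p < K" "a < 2" "v \<in> {?g0, ?g1}" for p a v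
    using block[OF ijk(1) that(1), of "unit_vec (2 * p + a)" v] two[OF that(2)] that(3) by auto
  show "Q i (unit_vec j) (unit_vec k) = 0"
    using index[OF ijk(2)] index[OF ijk(3)]
  proof (elim disjE exE conjE)
    fix p a q b assume *: "p < K" "a < 2" "j = 2 * p + a" "q < K" "b < 2" "k = 2 * q + b"
    show ?thesis
    proof (cases "p = q")
      case True
      then show ?thesis
        using block[OF ijk(1) *(1), of "unit_vec j" "unit_vec k"] two[OF *(2)] two[OF *(5)] * by auto
    next
      case False
      then show ?thesis using cross * ijk(1) by blast
    qed
  next
    fix p a assume "p < K" "a < 2" "j = 2 * p + a" "unit_vec k \<in> {?g0, ?g1}"
    then show ?thesis using mixed by blast
  next
    fix p a assume "p < K" "a < 2" "k = 2 * p + a" "unit_vec j \<in> {?g0, ?g1}"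
    then show ?thesis using mixed sym by metis
  next
    assume "unit_vec j \<in> {?g0, ?g1}" "unit_vec k \<in> {?g0, ?g1}"
    then show ?thesis using base[OF ijk(1)] sym by auto
  qed
qed

text \<open>
  The last summand is \<open>0\<close>, \<open>1\<close>, \<open>3\<close> for \<open>r = 0, 1, 2\<close>.
\<close>

lemma card_configuration:
  assumes "r \<le> 2"
  shows "finite (configuration m r K)"
    "card (configuration m r K) \<le> (m + 1) * K + (if r = 0 then 0 else 2 * r - 1)"
proof -
  let ?B = "(\<lambda>(p, z). (block_x m p z, block_y r K p z)) ` ({..<K} \<times> {z. z ^ Suc m = 1})"
  have fin: "finite {z :: complex. z ^ Suc m = 1}" by (rule finite_nth_roots) simp
  have "card ?B \<le> card ({..<K} \<times> {z :: complex. z ^ Suc m = 1})"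
    using fin by (intro card_image_le) auto
  also have "\<dots> = K * Suc m"
    using card_nth_roots[of 1 "Suc m"] by (simp add: card_cartesian_product)
  finally have B: "card ?B \<le> (m + 1) * K" by (simp add: mult.commute)
  have "finite (base_points r K)" by (simp add: base_points_def)
  then show "finite (configuration m r K)" using fin by (simp add: configuration_def)
  have "r = 0 \<or> r = 1 \<or> r = 2" using assms by auto
  then have "card (base_points r K) \<le> (if r = 0 then 0 else 2 * r - 1)"
    by (elim disjE) (auto simp: base_points_def card_insert_if)
  then show "card (configuration m r K) \<le> (m + 1) * K + (if r = 0 then 0 else 2 * r - 1)"
    unfolding configuration_def using B card_Un_le[of "base_points r K" ?B] by linarith
qed

lemma configuration_nonzero:
  assumes "(x, y) \<in> configuration m r K" and n: "n + 1 = 2 * K + r" and "r \<le> 2"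
  shows "x \<in> coord_space {..m} - {0}" "y \<in> coord_space {..n} - {0}"
proof -
  consider (base) "x = unit_vec 0" "r \<ge> 1" "y = base_vec0 r K"
    | (base') "x = unit_vec 0" "r \<ge> 2" "y = base_vec1 r K"
    | (base'') "x = unit_vec 0" "r \<ge> 2" "y = (\<lambda>l. base_vec0 r K l + base_vec1 r K l)"
    | (block) p z where "p < K" "x = block_x m p z" "y = block_y r K p z"
    using assms(1) by (auto simp: configuration_def base_points_def split: if_splits)
  then have "x \<in> coord_space {..m} - {0} \<and> y \<in> coord_space {..n} - {0}"
  proof cases
    case base
    then show ?thesis
      using n unit_vec_in_coord_space[of 0 "{..m}"] unit_vec_in_coord_space[of "2 * K" "{..n}"]
      by (simp add: base_vec0_def)
  next
    case base'
    then show ?thesis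
      using n unit_vec_in_coord_space[of 0 "{..m}"] unit_vec_in_coord_space[of "2 * K + 1" "{..n}"]
      by (simp add: base_vec1_def)
  next
    case base''
    then have "y (2 * K) \<noteq> 0" by (simp add: base_vec0_def base_vec1_def unit_vec_def)
    then have "y \<noteq> 0" by (metis zero_fun_apply)
    moreover have "y \<in> coord_space {..n}"
      using base'' n by (auto simp: coord_space_def base_vec0_def base_vec1_def unit_vec_def)
    ultimately show ?thesis using base'' unit_vec_in_coord_space[of 0 "{..m}"] by auto
  next
    case block
    then have "x 0 \<noteq> 0" by (simp add: block_x_def)
    moreover have "y (2 * p) \<noteq> 0"
      using block by (simp add: block_y_def base_vec0_def base_vec1_def unit_vec_def)
    ultimately have "x \<noteq> 0" "y \<noteq> 0" by (metis zero_fun_apply)+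
    moreover have "x \<in> coord_space {..m}" using block by (simp add: coord_space_def block_x_def)
    moreover have "y \<in> coord_space {..n}"
      using block n by (auto simp: coord_space_def block_y_def base_vec0_def base_vec1_def unit_vec_def)
    ultimately show ?thesis by blast
  qed
  then show "x \<in> coord_space {..m} - {0}" "y \<in> coord_space {..n} - {0}" by blast+
qed

text \<open>
  For \<open>m = 1\<close>: the basis vectors \<open>e\<^sub>j\<close>, paired with distinct points of \<open>P\<^sup>1\<close>.
\<close>

definition pencil_configuration :: "nat \<Rightarrow> ((nat \<Rightarrow> complex) \<times> (nat \<Rightarrow> complex)) set" where
  "pencil_configuration n =
     (\<lambda>j. (\<lambda>i. if i = 0 then 1 else if i = 1 then of_nat j else 0, unit_vec j)) ` {..n}"

text \<open>
  Each entry \<open>(j, k)\<close>, \<open>j \<noteq> k\<close>, of the pencil is killed by two different points of \<open>P\<^sup>1\<close>.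
\<close>

lemma pencil_configuration_spanning: "spanning_configuration 1 n (pencil_configuration n)"
  unfolding spanning_configuration_def
proof (intro allI impI)
  fix Q :: "nat \<Rightarrow> (nat \<Rightarrow> complex) \<Rightarrow> (nat \<Rightarrow> complex) \<Rightarrow> complex" and i j k :: nat
  assume Q: "\<forall>i\<le>1. sym_bilinear (Q i)"
    and P: "\<forall>(x, y)\<in>pencil_configuration n.
      (\<forall>i\<le>1. Q i y y = 0) \<and> (\<forall>l\<le>n. (\<Sum>i\<le>1. x i * Q i y (unit_vec l)) = 0)"
    and ijk: "i \<le> 1" "j \<le> n" "k \<le> n"
  have diag: "Q i (unit_vec j) (unit_vec j) = 0" if "i \<le> 1" "j \<le> n" for i j
    using P that by (auto simp: pencil_configuration_def)
  have rel: "Q 0 (unit_vec j) (unit_vec l) + of_nat j * Q 1 (unit_vec j) (unit_vec l) = 0"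
    if "j \<le> n" "l \<le> n" for j l
    using P that by (auto simp: pencil_configuration_def)
  have sym: "Q i (unit_vec j) (unit_vec k) = Q i (unit_vec k) (unit_vec j)" if "i \<le> 1" for i
    using Q sym_bilinearD(1) that by blast
  show "Q i (unit_vec j) (unit_vec k) = 0"
  proof (cases "j = k")
    case True
    then show ?thesis using diag ijk by simp
  next
    case False
    have "Q 0 (unit_vec j) (unit_vec k) + of_nat k * Q 1 (unit_vec j) (unit_vec k) = 0"
      using rel[OF ijk(3,2)] sym[of 0] sym[of 1] by simp
    with rel[OF ijk(2,3)] have "(of_nat j - of_nat k) * Q 1 (unit_vec j) (unit_vec k) = 0"
      by algebra
    then have "Q 1 (unit_vec j) (unit_vec k) = 0" using False by simp
    moreover from this have "Q 0 (unit_vec j) (unit_vec k) = 0" using rel[of j k] ijk by simp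
    moreover have "i = 0 \<or> i = 1" using ijk(1) by auto
    ultimately show ?thesis by auto
  qed
qed

lemma ex_spanning_configuration:
  assumes "m \<ge> 1" "s \<ge> s_bar m n"
  shows "\<exists>P. P \<noteq> {} \<and> finite P \<and> card P \<le> s \<and> spanning_configuration m n P \<and>
    (\<forall>(x, y)\<in>P. x \<in> coord_space {..m} - {0} \<and> y \<in> coord_space {..n} - {0})"
proof (cases "m = 1")
  case True
  have "card (pencil_configuration n) \<le> Suc n"
    unfolding pencil_configuration_def using card_image_le[of "{..n}"] by simp
  also have "Suc n \<le> s_bar 1 n" unfolding s_bar_def by presburger
  also have "\<dots> \<le> s" using assms(2) True by simp
  finally have "card (pencil_configuration n) \<le> s" .
  moreover have "x \<in> coord_space {..m} - {0} \<and> y \<in> coord_space {..n} - {0}"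
    if xy: "(x, y) \<in> pencil_configuration n" for x y
  proof -
    obtain j where j: "j \<le> n" "x = (\<lambda>i. if i = 0 then 1 else if i = 1 then of_nat j else 0)"
        "y = unit_vec j"
      using xy by (auto simp: pencil_configuration_def)
    then have "x 0 \<noteq> 0" by simp
    then have "x \<noteq> 0" by (metis zero_fun_apply)
    then show ?thesis
      using j True unit_vec_in_coord_space[of j "{..n}"] by (simp add: coord_space_def)
  qed
  ultimately show ?thesis
    using pencil_configuration_spanning[of n] True
    by (intro exI[of _ "pencil_configuration n"]) (auto simp: pencil_configuration_def)
next
  case False
  have *: ?thesis if r: "r \<le> 2" "r \<le> m - 1" and n: "n + 1 = 2 * K + r"
      and s: "(m + 1) * K + (if r = 0 then 0 else 2 * r - 1) \<le> s" for r K
  proof (intro exI conjI)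
    show "configuration m r K \<noteq> {}"
    proof (cases "K = 0")
      case True
      then have "r \<ge> 1" using n by simp
      then show ?thesis by (simp add: configuration_def base_points_def)
    next
      case False
      then have "(0, 1) \<in> {..<K} \<times> {z :: complex. z ^ Suc m = 1}" by simp
      then show ?thesis unfolding configuration_def by blast
    qed
    show "card (configuration m r K) \<le> s"
      using card_configuration(2)[OF r(1), of m K] s by linarith
    show "\<forall>(x, y)\<in>configuration m r K. x \<in> coord_space {..m} - {0} \<and> y \<in> coord_space {..n} - {0}"
      using configuration_nonzero[OF _ n r(1)] by blast
  qed (use card_configuration(1)[OF r(1)] configuration_spanning[OF assms(1) r n] in auto)
  \<comment> \<open>The base has dimension \<open>1\<close>, \<open>0\<close>, \<open>2\<close> in the three cases.\<close>
  consider "even n" | "odd n" "m = 2" | "odd n" "m \<ge> 3" using False assms(1) by linarith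
  then show ?thesis
  proof cases
    case 1
    then show ?thesis using False assms by (intro *[of 1 "n div 2"]) (auto simp: s_bar_def)
  next
    case 2
    then show ?thesis using assms by (intro *[of 0 "n div 2 + 1"]) (auto simp: s_bar_def)
  next
    case 3
    then show ?thesis using assms by (intro *[of 2 "n div 2"]) (auto simp: s_bar_def)
  qed
qed

section \<open>The dimension of the Segre-Veronese variety\<close>

lemma segre_veronese_sub_eq:
  assumes "a \<le> m" "b \<le> n"
  shows "segre_veronese a b = proj_space (sv_index a b) \<inter> segre_veronese m n"
proof (intro equalityI subsetI)
  fix q assume q: "q \<in> segre_veronese a b"
  then obtain x y where "q = proj_point (sv_map x y)"
    "x \<in> coord_space {..a} - {0}" "y \<in> coord_space {..b} - {0}"
    by (auto simp: segre_veronese_def)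
  moreover from this have "x \<in> coord_space {..m} - {0}" "y \<in> coord_space {..n} - {0}"
    using assms by (auto simp: coord_space_def)
  ultimately have "q \<in> segre_veronese m n" unfolding segre_veronese_def by blast
  then show "q \<in> proj_space (sv_index a b) \<inter> segre_veronese m n"
    using q segre_veronese_subset by blast
next
  fix q assume q: "q \<in> proj_space (sv_index a b) \<inter> segre_veronese m n"
  then obtain x y where xy: "q = proj_point (sv_map x y)" "x \<noteq> 0" "y \<noteq> 0"
    by (auto simp: segre_veronese_def)
  have "sv_map x y \<in> coord_space (sv_index a b)"
    using q proj_point_in_proj_space_iff unfolding xy(1) by blast
  then have sv: "sv_map x y idx = 0" if "idx \<notin> sv_index a b" for idx
    using that unfolding coord_space_def by blast
  obtain i0 j0 where ij: "x i0 \<noteq> 0" "y j0 \<noteq> 0" using xy by (auto simp: fun_eq_iff)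
  have "x i = 0" if "i \<notin> {..a}" for i
    using sv[of "(i, j0, j0)"] that ij by (auto simp: sv_index_def sv_map_def)
  moreover have "y j = 0" if "j \<notin> {..b}" for j
    using sv[of "(i0, j, j)"] that ij by (auto simp: sv_index_def sv_map_def)
  ultimately have "x \<in> coord_space {..a} - {0}" "y \<in> coord_space {..b} - {0}"
    using xy by (auto simp: coord_space_def)
  then show "q \<in> segre_veronese a b" using xy(1) unfolding segre_veronese_def by blast
qed

lemma sv_map_in_coord_space:
  assumes "x \<in> coord_space {..m}" "y \<in> coord_space {..n}"
  shows "sv_map x y \<in> coord_space (sv_index m n)"
  using assms by (auto simp: coord_space_def sv_index_def sv_map_def)

lemma sv_map_nonzero:
  assumes "x \<in> coord_space {..m} - {0}" "y \<in> coord_space {..n} - {0}"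
  shows "sv_map x y \<noteq> 0"
proof -
  have "proj_point (sv_map x y) \<in> segre_veronese m n"
    using assms unfolding segre_veronese_def by blast
  then show ?thesis using segre_veronese_subset proj_point_in_proj_space_iff by blast
qed

lemma segre_veronese_irreducible:
  assumes "a \<le> m" "b \<le> n"
  shows "irreducible_space (subtopology (zariski (sv_index m n)) (segre_veronese a b))"
proof -
  define S where "S = {sv_map x y |x y. x \<in> coord_space {..a} - {0} \<and> y \<in> coord_space {..b} - {0}}"
  have "segre_veronese a b = proj_point ` S" by (auto simp: segre_veronese_def S_def)
  moreover have "irreducible_space (subtopology (zariski (sv_index m n)) (proj_point ` S))"
  proof (rule irreducible_of_curves)
    have "coord_space (sv_index a b) \<subseteq> (coord_space (sv_index m n) :: (nat \<times> nat \<times> nat \<Rightarrow> complex) set)"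
      using assms by (auto simp: coord_space_def sv_index_def)
    moreover have "S \<subseteq> coord_space (sv_index a b) - {0}"
    proof
      fix u assume "u \<in> S"
      then obtain x y where u: "u = sv_map x y"
        "x \<in> coord_space {..a} - {0}" "y \<in> coord_space {..b} - {0}"
        by (auto simp: S_def)
      show "u \<in> coord_space (sv_index a b) - {0}"
        using sv_map_in_coord_space[of x a y b] sv_map_nonzero[OF u(2,3)] u by simp
    qed
    ultimately show "S \<subseteq> coord_space (sv_index m n) - {0}" by (meson Diff_mono order_refl order_trans)
    have "unit_vec 0 \<in> coord_space {..a} - {0 :: nat \<Rightarrow> complex}"
      "unit_vec 0 \<in> coord_space {..b} - {0 :: nat \<Rightarrow> complex}"
      by (intro unit_vec_in_coord_space, simp)+
    then have "sv_map (unit_vec 0) (unit_vec 0) \<in> S"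
      unfolding S_def mem_Collect_eq
      by (intro exI[of _ "unit_vec 0"] exI[of _ "unit_vec 0"] conjI) (rule refl)
    then show "S \<noteq> {}" by auto
    fix u v assume "u \<in> S" "v \<in> S"
    then obtain x y x' y' where
      u: "u = sv_map x y" "x \<in> coord_space {..a}" "y \<in> coord_space {..b}" and
      v: "v = sv_map x' y'" "x' \<in> coord_space {..a}" "y' \<in> coord_space {..b}"
      unfolding S_def by blast
    define P where "P = (\<lambda>(i, j, k). if j \<le> k then
      [:x i, x' i - x i:] * [:y j, y' j - y j:] * [:y k, y' k - y k:] else 0)"
    have P: "(\<lambda>idx. poly (P idx) t) =
        sv_map (\<lambda>i. x i + t * (x' i - x i)) (\<lambda>j. y j + t * (y' j - y j))" for t
      by (auto simp: P_def sv_map_def fun_eq_iff simp del: mult_pCons_left mult_pCons_right)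
    have "(\<lambda>idx. poly (P idx) t) \<in> S" if nz: "(\<lambda>idx. poly (P idx) t) \<noteq> 0" for t
    proof -
      let ?x = "\<lambda>i. x i + t * (x' i - x i)" and ?y = "\<lambda>j. y j + t * (y' j - y j)"
      have "?x \<in> coord_space {..a}" "?y \<in> coord_space {..b}"
        using u v by (auto simp: coord_space_def)
      moreover have "sv_map 0 w = 0" "sv_map w 0 = 0" for w
        by (auto simp: sv_map_def fun_eq_iff)
      then have "?x \<noteq> 0" "?y \<noteq> 0" using nz unfolding P by metis+
      ultimately show ?thesis unfolding P S_def by blast
    qed
    moreover have "\<forall>idx. poly (P idx) 0 = u idx" "\<forall>idx. poly (P idx) 1 = v idx"
      using fun_cong[OF P[of 0]] fun_cong[OF P[of 1]] by (simp_all add: u(1) v(1))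
    ultimately show "\<exists>P. (\<forall>i. poly (P i) 0 = u i) \<and> (\<forall>i. poly (P i) 1 = v i) \<and>
       (\<forall>t. (\<lambda>i. poly (P i) t) \<noteq> 0 \<longrightarrow> (\<lambda>i. poly (P i) t) \<in> S)"
      by blast
  qed
  ultimately show ?thesis by simp
qed

text \<open>
  The chain is \<open>P\<^sup>0 \<times> P\<^sup>0 \<subset> P\<^sup>1 \<times> P\<^sup>0 \<subset> \<dots> \<subset> P\<^sup>m \<times> P\<^sup>0 \<subset> P\<^sup>m \<times> P\<^sup>1 \<subset> \<dots> \<subset> P\<^sup>m \<times> P\<^sup>n\<close>.
\<close>

lemma variety_dim_segre_veronese_ge:
  "enat (m + n) \<le> variety_dim (sv_index m n) (segre_veronese m n)"
  unfolding variety_dim_def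
proof (rule krull_dim_ge[where Z = "\<lambda>i. segre_veronese (min i m) (i - m)"])
  fix i assume i: "i \<le> m + n"
  let ?a = "min i m" and ?b = "i - m"
  have ab: "?a \<le> m" "?b \<le> n" using i by auto
  have "sv_index ?a ?b \<subseteq> sv_index m n" using ab by (auto simp: sv_index_def)
  then have "closedin (zariski (sv_index m n)) (proj_space (sv_index ?a ?b))"
    unfolding closedin_zariski
    by (intro exI[of _ "coord_poly ` (sv_index m n - sv_index ?a ?b)"] conjI coord_subspace_zero_locus)
       (auto intro: coord_poly_homogeneous)
  then show "closedin (subtopology (zariski (sv_index m n)) (segre_veronese m n)) (segre_veronese ?a ?b)"
    unfolding closedin_subtopology using segre_veronese_sub_eq[OF ab] by blast
  have "segre_veronese m n \<inter> segre_veronese ?a ?b = segre_veronese ?a ?b"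
    using segre_veronese_sub_eq[OF ab] by blast
  then show "irreducible_space (subtopology (subtopology (zariski (sv_index m n)) (segre_veronese m n))
      (segre_veronese ?a ?b))"
    using segre_veronese_irreducible[OF ab] by (simp add: subtopology_subtopology)
next
  fix i assume i: "i < m + n"
  let ?a = "min i m" and ?b = "i - m" and ?a' = "min (Suc i) m" and ?b' = "Suc i - m"
  have "segre_veronese ?a ?b \<subseteq> segre_veronese ?a' ?b'"
    using segre_veronese_sub_eq[of ?a ?a' ?b ?b'] by auto
  moreover have "proj_point (sv_map (unit_vec ?a') (unit_vec ?b')) \<in> segre_veronese ?a' ?b'"
    using unit_vec_in_coord_space[of ?a' "{..?a'}"] unit_vec_in_coord_space[of ?b' "{..?b'}"]
    unfolding segre_veronese_def by blast
  moreover have "proj_point (sv_map (unit_vec ?a') (unit_vec ?b')) \<notin> segre_veronese ?a ?b"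
  proof -
    have "(?a', ?b', ?b') \<notin> sv_index ?a ?b" by (auto simp: sv_index_def)
    moreover have "sv_map (unit_vec ?a') (unit_vec ?b') (?a', ?b', ?b') \<noteq> 0"
      by (simp add: sv_map_def unit_vec_def)
    ultimately have "sv_map (unit_vec ?a') (unit_vec ?b') \<notin> coord_space (sv_index ?a ?b)"
      unfolding coord_space_def by blast
    then show ?thesis
      using segre_veronese_subset[of ?a ?b] proj_point_in_proj_space_iff by blast
  qed
  ultimately show "segre_veronese ?a ?b \<subset> segre_veronese ?a' ?b'" by blast
qed

section \<open>Tangent spaces and density of the secant variety\<close>

lemma separating_functional:
  assumes I: "finite I" and U: "cfun.subspace U" "U \<subseteq> coord_space I"
    and w: "w \<in> coord_space I" "w \<notin> U"
  shows "\<exists>T. (\<forall>u\<in>U. (\<Sum>i\<in>I. T i * u i) = 0) \<and> (\<Sum>i\<in>I. T i * w i) \<noteq> 0"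
proof -
  interpret vp: vector_space_pair "\<lambda>c (v :: 'a \<Rightarrow> complex) i. c * v i" "(*) :: complex \<Rightarrow> _"
    by unfold_locales (auto simp: fun_eq_iff algebra_simps)
  obtain B where B: "B \<subseteq> U" "cfun.independent B" "U \<subseteq> cspan B"
    using cfun.maximal_independent_subset by blast
  have "w \<notin> cspan B" using cfun.span_minimal[OF B(1) U(1)] w(2) by blast
  then have "cfun.independent (insert w B)" using B(2) by (simp add: cfun.independent_insertI)
  then obtain g where g: "Vector_Spaces.linear (\<lambda>c v i. c * v i) (*) g"
    "\<forall>x\<in>insert w B. g x = (if x = w then 1 else 0)"
    using vp.linear_independent_extend[of "insert w B" "\<lambda>x. if x = w then 1 else 0"] by blast
  have B0: "g b = 0" if "b \<in> B" for b
    using g(2) that cfun.span_base[of b B] \<open>w \<notin> cspan B\<close> by auto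
  have gU: "g u = 0" if "u \<in> U" for u
  proof -
    have "cfun.subspace {v. g v = 0}"
      using vp.linear_0[OF g(1)] vp.linear_add[OF g(1)] vp.linear_scale[OF g(1)]
      by (simp add: cfun.subspace_def)
    then have "cspan B \<subseteq> {v. g v = 0}" using B0 by (intro cfun.span_minimal) auto
    then show ?thesis using B(3) that by blast
  qed
  have expand: "g v = (\<Sum>i\<in>I. g (unit_vec i) * v i)" if v: "v \<in> coord_space I" for v
  proof -
    have "v = (\<Sum>i\<in>I. (\<lambda>j. v i * unit_vec i j))"
    proof
      fix j
      have "(\<Sum>i\<in>I. v i * unit_vec i j) = (\<Sum>i\<in>I. if i = j then v j else 0)"
        by (intro sum.cong) (auto simp: unit_vec_def)
      also have "\<dots> = v j" using I v by (auto simp: coord_space_def)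
      finally show "v j = (\<Sum>i\<in>I. (\<lambda>j. v i * unit_vec i j)) j" by (simp add: sum_fun_apply)
    qed
    then have "g v = g (\<Sum>i\<in>I. (\<lambda>j. v i * unit_vec i j))" by simp
    also have "\<dots> = (\<Sum>i\<in>I. g (\<lambda>j. v i * unit_vec i j))" by (rule vp.linear_sum[OF g(1)])
    also have "\<dots> = (\<Sum>i\<in>I. g (unit_vec i) * v i)"
      using vp.linear_scale[OF g(1)] by (intro sum.cong) (auto simp: mult.commute)
    finally show ?thesis .
  qed
  show ?thesis
  proof (intro exI[of _ "\<lambda>i. g (unit_vec i)"] conjI ballI)
    show "(\<Sum>i\<in>I. g (unit_vec i) * u i) = 0" if "u \<in> U" for u
      using expand[of u] gU that U(2) by auto
    show "(\<Sum>i\<in>I. g (unit_vec i) * w i) \<noteq> 0"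
      using expand[OF w(1)] g(2) by simp
  qed
qed

text \<open>
  The coefficients of \<open>t\<close> and \<open>t\<^sup>2\<close> in \<open>sv_map (x + t a) (y + t b)\<close>; the coefficient of \<open>t\<^sup>3\<close> is
  \<open>sv_map a b\<close>.
\<close>

definition sv_tangent ::
  "(nat \<Rightarrow> complex) \<Rightarrow> (nat \<Rightarrow> complex) \<Rightarrow> (nat \<Rightarrow> complex) \<Rightarrow> (nat \<Rightarrow> complex) \<Rightarrow>
    nat \<times> nat \<times> nat \<Rightarrow> complex" where
  "sv_tangent x y a b =
     (\<lambda>(i, j, k). if j \<le> k then a i * (y j * y k) + x i * (b j * y k + b k * y j) else 0)"

definition sv_second ::
  "(nat \<Rightarrow> complex) \<Rightarrow> (nat \<Rightarrow> complex) \<Rightarrow> (nat \<Rightarrow> complex) \<Rightarrow> (nat \<Rightarrow> complex) \<Rightarrow>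
    nat \<times> nat \<times> nat \<Rightarrow> complex" where
  "sv_second x y a b =
     (\<lambda>(i, j, k). if j \<le> k then a i * (b j * y k + b k * y j) + x i * b j * b k else 0)"

lemma sv_map_expand:
  "sv_map (\<lambda>i. x i + t * a i) (\<lambda>j. y j + t * b j) idx =
     sv_map x y idx + t * (sv_tangent x y a b idx + t * (sv_second x y a b idx + t * sv_map a b idx))"
  by (cases idx) (simp add: sv_map_def sv_tangent_def sv_second_def algebra_simps)

lemma sv_tangent_in_coord_space:
  assumes "x \<in> coord_space {..m}" "y \<in> coord_space {..n}" "a \<in> coord_space {..m}" "b \<in> coord_space {..n}"
  shows "sv_tangent x y a b \<in> coord_space (sv_index m n)"
    "sv_second x y a b \<in> coord_space (sv_index m n)"
  using assms by (auto simp: coord_space_def sv_index_def sv_tangent_def sv_second_def)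

lemma sum_sv_index:
  fixes T v :: "nat \<times> nat \<times> nat \<Rightarrow> complex"
  shows
  "(\<Sum>idx\<in>sv_index m n. T idx * v idx) =
     (\<Sum>i\<le>m. \<Sum>j\<le>n. \<Sum>k\<le>n. (if j \<le> k then T (i, j, k) else 0) * v (i, j, k))"
proof -
  have "(\<Sum>i\<le>m. \<Sum>j\<le>n. \<Sum>k\<le>n. (if j \<le> k then T (i, j, k) else 0) * v (i, j, k)) =
      (\<Sum>(i, j, k)\<in>{..m} \<times> {..n} \<times> {..n}. (if j \<le> k then T (i, j, k) else 0) * v (i, j, k))"
    by (simp add: sum.cartesian_product)
  also have "\<dots> = (\<Sum>idx\<in>sv_index m n. T idx * v idx)"
    by (intro sum.mono_neutral_cong_right) (auto simp: sv_index_def split: if_splits)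
  finally show ?thesis by simp
qed

lemma sum_unit_vec:
  fixes k n :: nat
  assumes "k \<le> n"
  shows "(\<Sum>l\<le>n. c l * unit_vec k l) = c k"
proof -
  have "(\<Sum>l\<le>n. c l * unit_vec k l) = (\<Sum>l\<le>n. if l = k then c k else 0)"
    by (intro sum.cong) (auto simp: unit_vec_def)
  then show ?thesis using assms by simp
qed

text \<open>
  The symmetric bilinear forms attached to a linear functional \<open>T\<close> on the ambient space: \<open>T\<close> has a
  coefficient for each \<open>j \<le> k\<close> only, and the coefficients off the diagonal are halved.
\<close>

definition polar_form ::
  "nat \<Rightarrow> (nat \<times> nat \<times> nat \<Rightarrow> complex) \<Rightarrow> nat \<Rightarrow>
    (nat \<Rightarrow> complex) \<Rightarrow> (nat \<Rightarrow> complex) \<Rightarrow> complex" where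
  "polar_form n T i u v = (\<Sum>j\<le>n. \<Sum>k\<le>n.
     ((if j \<le> k then T (i, j, k) else 0) + (if k \<le> j then T (i, k, j) else 0)) / 2 * u j * v k)"

lemma functional_on_tangents:
  fixes T :: "nat \<times> nat \<times> nat \<Rightarrow> complex" and n :: nat
  defines "Q \<equiv> polar_form n T"
  shows "sym_bilinear (Q i)"
    and "(\<Sum>idx\<in>sv_index m n. T idx * sv_tangent x y a b idx) =
      (\<Sum>i\<le>m. a i * Q i y y) + 2 * (\<Sum>i\<le>m. x i * Q i y b)"
    and "j \<le> n \<Longrightarrow> k \<le> n \<Longrightarrow> j \<le> k \<Longrightarrow>
      T (i, j, k) = (if j = k then 1 else 2) * Q i (unit_vec j) (unit_vec k)"
proof -
  define T' where "T' i j k = (if j \<le> k then T (i, j, k) else 0)" for i j k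
  have Q: "Q i u v = (\<Sum>j\<le>n. \<Sum>k\<le>n. (T' i j k + T' i k j) / 2 * u j * v k)" for i u v
    by (simp add: Q_def T'_def polar_form_def)
  have sym: "Q i u v = Q i v u" for i u v
    unfolding Q by (subst sum.swap) (simp add: algebra_simps)
  show "sym_bilinear (Q i)" for i
    unfolding sym_bilinear_def
  proof (intro conjI allI)
    show "Q i u v = Q i v u" for u v by (rule sym)
    show "Q i (\<lambda>i. u i + v i) w = Q i u w + Q i v w" for u v w
      unfolding Q by (simp add: algebra_simps sum.distrib)
    show "Q i (\<lambda>i. c * u i) w = c * Q i u w" for c u w
      unfolding Q by (simp add: sum_distrib_left mult_ac)
  qed
  have polar: "(\<Sum>j\<le>n. \<Sum>k\<le>n. T' i j k * (u j * v k + u k * v j)) = 2 * Q i u v" for i u v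
  proof -
    have "(\<Sum>j\<le>n. \<Sum>k\<le>n. T' i j k * (u k * v j)) = (\<Sum>j\<le>n. \<Sum>k\<le>n. T' i k j * (u j * v k))"
      by (rule sum.swap)
    then have "(\<Sum>j\<le>n. \<Sum>k\<le>n. T' i j k * (u j * v k + u k * v j)) =
        (\<Sum>j\<le>n. \<Sum>k\<le>n. T' i j k * (u j * v k) + T' i k j * (u j * v k))"
      by (simp add: distrib_left sum.distrib)
    also have "\<dots> = 2 * Q i u v"
      unfolding Q sum_distrib_left by (intro sum.cong refl) (simp add: algebra_simps)
    finally show ?thesis .
  qed
  have diag: "(\<Sum>j\<le>n. \<Sum>k\<le>n. T' i j k * (y j * y k)) = Q i y y" for i
  proof -
    have "2 * (\<Sum>j\<le>n. \<Sum>k\<le>n. T' i j k * (y j * y k)) = 2 * Q i y y"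
      unfolding polar[symmetric] sum_distrib_left by (intro sum.cong refl) (simp add: algebra_simps)
    then show ?thesis by simp
  qed
  have "(\<Sum>idx\<in>sv_index m n. T idx * sv_tangent x y a b idx) =
      (\<Sum>i\<le>m. \<Sum>j\<le>n. \<Sum>k\<le>n. T' i j k * (a i * (y j * y k) + x i * (b j * y k + b k * y j)))"
    unfolding sum_sv_index by (intro sum.cong refl) (simp add: T'_def sv_tangent_def)
  also have "\<dots> = (\<Sum>i\<le>m. a i * (\<Sum>j\<le>n. \<Sum>k\<le>n. T' i j k * (y j * y k)) +
      x i * (\<Sum>j\<le>n. \<Sum>k\<le>n. T' i j k * (b j * y k + b k * y j)))"
    unfolding sum_distrib_left sum.distrib[symmetric]
    by (intro sum.cong refl) (simp add: algebra_simps)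
  also have "\<dots> = (\<Sum>i\<le>m. a i * Q i y y) + 2 * (\<Sum>i\<le>m. x i * Q i y b)"
    unfolding polar diag sum.distrib sum_distrib_left sym[of _ b y] by (simp add: mult_ac)
  finally show "(\<Sum>idx\<in>sv_index m n. T idx * sv_tangent x y a b idx) =
      (\<Sum>i\<le>m. a i * Q i y y) + 2 * (\<Sum>i\<le>m. x i * Q i y b)" .
  show "T (i, j, k) = (if j = k then 1 else 2) * Q i (unit_vec j) (unit_vec k)"
    if "j \<le> n" "k \<le> n" "j \<le> k"
  proof -
    have "Q i (unit_vec j) (unit_vec k) =
        (\<Sum>j'\<le>n. \<Sum>k'\<le>n. (T' i j' k' + T' i k' j') / 2 * unit_vec j j' * unit_vec k k')"
      by (rule Q)
    also have "\<dots> = (T' i j k + T' i k j) / 2"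
      by (simp only: sum_unit_vec[OF that(1)] sum_unit_vec[OF that(2)])
    finally show ?thesis using that by (cases "j = k") (auto simp: T'_def mult.commute)
  qed
qed

text \<open>
  Tangent vectors at the points of a spanning configuration sum up to any prescribed vector \<open>w\<close>.
\<close>

lemma tangents_span:
  fixes X Y :: "nat \<Rightarrow> nat \<Rightarrow> complex"
  assumes P: "spanning_configuration m n ((\<lambda>l. (X l, Y l)) ` {..<s})"
    and XY: "\<And>l. l < s \<Longrightarrow> X l \<in> coord_space {..m}" "\<And>l. l < s \<Longrightarrow> Y l \<in> coord_space {..n}"
    and w: "w \<in> coord_space (sv_index m n)"
  shows "\<exists>A B. (\<forall>l. A l \<in> coord_space {..m}) \<and> (\<forall>l. B l \<in> coord_space {..n}) \<and>
    w = (\<lambda>idx. \<Sum>l<s. sv_tangent (X l) (Y l) (A l) (B l) idx)"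
proof (rule ccontr)
  assume neg: "\<not> ?thesis"
  define D where "D A B = (\<lambda>idx. \<Sum>l<s. sv_tangent (X l) (Y l) (A l) (B l) idx)" for A B
  define U where "U = {D A B |A B. (\<forall>l. A l \<in> coord_space {..m}) \<and> (\<forall>l. B l \<in> coord_space {..n})}"
  have fin: "finite (sv_index m n)"
    by (rule finite_subset[of _ "{..m} \<times> {..n} \<times> {..n}"]) (auto simp: sv_index_def)
  have "cfun.subspace U"
    unfolding cfun.subspace_def
  proof (intro conjI ballI allI)
    have "D (\<lambda>l i. 0) (\<lambda>l i. 0) idx = 0" for idx
      by (cases idx) (simp add: D_def sv_tangent_def cong: if_cong)
    then have "0 = D (\<lambda>l i. 0) (\<lambda>l i. 0)" by (simp add: fun_eq_iff)
    then show "0 \<in> U" unfolding U_def by (auto simp: coord_space_def)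
    fix u assume "u \<in> U"
    then obtain A B where u: "u = D A B" "\<forall>l. A l \<in> coord_space {..m}" "\<forall>l. B l \<in> coord_space {..n}"
      by (auto simp: U_def)
    show "(\<lambda>i. c * u i) \<in> U" for c
    proof -
      have "c * u idx = D (\<lambda>l i. c * A l i) (\<lambda>l i. c * B l i) idx" for idx
        unfolding u(1) D_def sum_distrib_left
        by (cases idx, intro sum.cong refl) (simp add: sv_tangent_def algebra_simps)
      moreover have "\<forall>l. (\<lambda>i. c * A l i) \<in> coord_space {..m}" "\<forall>l. (\<lambda>i. c * B l i) \<in> coord_space {..n}"
        using u(2,3) by (simp_all add: coord_space_def)
      ultimately show ?thesis unfolding U_def fun_eq_iff mem_Collect_eq by blast
    qed
    show "u + v \<in> U" if "v \<in> U" for v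
    proof -
      from that obtain A' B' where v: "v = D A' B'" "\<forall>l. A' l \<in> coord_space {..m}" "\<forall>l. B' l \<in> coord_space {..n}"
        by (auto simp: U_def)
      have "(u + v) idx = D (\<lambda>l i. A l i + A' l i) (\<lambda>l i. B l i + B' l i) idx" for idx
        unfolding u(1) v(1) D_def plus_fun_apply sum.distrib[symmetric]
        by (cases idx, intro sum.cong refl) (simp add: sv_tangent_def algebra_simps)
      moreover have "\<forall>l. (\<lambda>i. A l i + A' l i) \<in> coord_space {..m}"
        "\<forall>l. (\<lambda>i. B l i + B' l i) \<in> coord_space {..n}"
        using u(2,3) v(2,3) by (simp_all add: coord_space_def)
      ultimately show ?thesis unfolding U_def fun_eq_iff mem_Collect_eq by blast
    qed
  qed
  moreover have "U \<subseteq> coord_space (sv_index m n)"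
  proof
    fix u assume "u \<in> U"
    then obtain A B where u: "u = D A B" "\<forall>l. A l \<in> coord_space {..m}" "\<forall>l. B l \<in> coord_space {..n}"
      by (auto simp: U_def)
    have "sv_tangent (X l) (Y l) (A l) (B l) \<in> coord_space (sv_index m n)" if "l < s" for l
      using u XY that by (intro sv_tangent_in_coord_space) auto
    then show "u \<in> coord_space (sv_index m n)" by (auto simp: u D_def coord_space_def)
  qed
  moreover have "w \<notin> U" using neg unfolding U_def D_def by blast
  ultimately obtain T where T: "\<And>u. u \<in> U \<Longrightarrow> (\<Sum>idx\<in>sv_index m n. T idx * u idx) = 0"
    "(\<Sum>idx\<in>sv_index m n. T idx * w idx) \<noteq> 0"
    using separating_functional[OF fin _ _ w] by blast
  define Q where "Q = polar_form n T"
  note fot = functional_on_tangents[where T = T and n = n, folded Q_def]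
  have tang: "(\<Sum>i\<le>m. a i * Q i (Y l) (Y l)) + 2 * (\<Sum>i\<le>m. X l i * Q i (Y l) b) = 0"
    if l: "l < s" and ab: "a \<in> coord_space {..m}" "b \<in> coord_space {..n}" for l a b
  proof -
    let ?A = "\<lambda>l'. if l' = l then a else (\<lambda>i. 0)" and ?B = "\<lambda>l'. if l' = l then b else (\<lambda>i. 0)"
    have "D ?A ?B = sv_tangent (X l) (Y l) a b"
    proof
      fix idx
      have "D ?A ?B idx = (\<Sum>l'<s. if l' = l then sv_tangent (X l) (Y l) a b idx else 0)"
        unfolding D_def by (intro sum.cong) (auto simp: sv_tangent_def split: prod.split)
      then show "D ?A ?B idx = sv_tangent (X l) (Y l) a b idx" using l by simp
    qed
    moreover have "\<forall>l'. ?A l' \<in> coord_space {..m}" "\<forall>l'. ?B l' \<in> coord_space {..n}"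
      using ab by (simp_all add: coord_space_def)
    then have "D ?A ?B \<in> U" unfolding U_def by blast
    ultimately have "(\<Sum>idx\<in>sv_index m n. T idx * sv_tangent (X l) (Y l) a b idx) = 0"
      using T(1) by metis
    then show ?thesis by (simp only: fot(2))
  qed
  have Q0: "\<forall>i\<le>m. \<forall>j\<le>n. \<forall>k\<le>n. Q i (unit_vec j) (unit_vec k) = 0"
  proof -
    have cond: "(\<forall>i\<le>m. Q i y y = 0) \<and> (\<forall>j\<le>n. (\<Sum>i\<le>m. x i * Q i y (unit_vec j)) = 0)"
      if xy: "(x, y) \<in> (\<lambda>l. (X l, Y l)) ` {..<s}" for x y
    proof -
      obtain l where l: "l < s" "x = X l" "y = Y l" using xy by auto
      have zero: "(\<lambda>i. 0) \<in> coord_space J" for J :: "nat set" by (simp add: coord_space_def)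
      have "Q i y y = 0" if "i \<le> m" for i
      proof -
        have "unit_vec i \<in> coord_space {..m}" using unit_vec_in_coord_space[of i "{..m}"] that by auto
        from tang[OF l(1) this zero] have "(\<Sum>i'\<le>m. unit_vec i i' * Q i' y y) = 0"
          using sym_bilinearD(7)[OF fot(1)] l by simp
        then show ?thesis
          using sum_unit_vec[OF that, of "\<lambda>i. Q i y y"] by (simp add: mult.commute)
      qed
      moreover have "(\<Sum>i\<le>m. x i * Q i y (unit_vec j)) = 0" if "j \<le> n" for j
      proof -
        have "unit_vec j \<in> coord_space {..n}" using unit_vec_in_coord_space[of j "{..n}"] that by auto
        from tang[OF l(1) zero this] show ?thesis using l by simp
      qed
      ultimately show ?thesis by blast
    qed
    have "\<forall>i\<le>m. sym_bilinear (Q i)" using fot(1) by blast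
    moreover have "\<forall>(x, y)\<in>(\<lambda>l. (X l, Y l)) ` {..<s}. (\<forall>i\<le>m. Q i y y = 0) \<and>
        (\<forall>j\<le>n. (\<Sum>i\<le>m. x i * Q i y (unit_vec j)) = 0)"
      using cond by blast
    ultimately show ?thesis
      by (rule P[unfolded spanning_configuration_def, THEN spec[of _ Q], THEN mp, THEN mp])
  qed
  have "T idx = 0" if "idx \<in> sv_index m n" for idx
  proof -
    from that obtain i j k where ijk: "idx = (i, j, k)" "i \<le> m" "j \<le> n" "k \<le> n" "j \<le> k"
      by (auto simp: sv_index_def)
    have "Q i (unit_vec j) (unit_vec k) = 0" using Q0 ijk by blast
    then show ?thesis using fot(3)[OF ijk(3,4,5), of i] ijk(1) by simp
  qed
  then show False using T(2) by simp
qed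

lemma cofinite_line_nonzero:
  assumes "u \<noteq> (0 :: 'a \<Rightarrow> complex)"
  shows "finite {t. (\<lambda>i. u i + t * v i) = 0}"
proof -
  obtain i where i: "u i \<noteq> 0" using assms by (auto simp: fun_eq_iff)
  have "{t. (\<lambda>i. u i + t * v i) = 0} \<subseteq> {t. poly [:u i, v i:] t = 0}"
    by (auto simp: fun_eq_iff)
  moreover have "finite {t. poly [:u i, v i:] t = 0}"
    using i by (intro poly_roots_finite) auto
  ultimately show ?thesis by (rule finite_subset)
qed

lemma secant_point:
  fixes x y :: "nat \<Rightarrow> nat \<Rightarrow> complex"
  assumes "\<And>l. l < s \<Longrightarrow> x l \<in> coord_space {..m} - {0}" "\<And>l. l < s \<Longrightarrow> y l \<in> coord_space {..n} - {0}"
    and v: "v = (\<lambda>idx. \<Sum>l<s. sv_map (x l) (y l) idx)" "v \<noteq> 0"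
  shows "proj_point v \<in> (\<Union>p\<in>{..<s} \<rightarrow> segre_veronese m n. proj_span (sv_index m n) (p ` {..<s}))"
proof
  let ?p = "\<lambda>l. proj_point (sv_map (x l) (y l))"
  show "?p \<in> {..<s} \<rightarrow> segre_veronese m n"
    using assms(1,2) unfolding segre_veronese_def by blast
  have "sv_map (x l) (y l) \<in> coord_space (sv_index m n)" if "l < s" for l
    using assms that by (intro sv_map_in_coord_space) auto
  then have "v \<in> coord_space (sv_index m n)" by (auto simp: v coord_space_def)
  then have "proj_point v \<in> proj_space (sv_index m n)"
    using v(2) proj_point_in_proj_space_iff by blast
  moreover have "v \<in> cspan (\<Union> (?p ` {..<s}))"
  proof -
    have "v = (\<Sum>l<s. sv_map (x l) (y l))" by (auto simp: v fun_eq_iff sum_fun_apply)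
    also have "\<dots> \<in> cspan (\<Union> (?p ` {..<s}))"
      using proj_point_self by (intro cfun.span_sum cfun.span_base) blast
    finally show ?thesis .
  qed
  then have "proj_point v \<subseteq> cspan (\<Union> (?p ` {..<s}))"
    unfolding proj_point_def by (intro cfun.span_minimal cfun.subspace_span) auto
  ultimately show "proj_point v \<in> proj_span (sv_index m n) (?p ` {..<s})"
    by (simp add: proj_span_def)
qed

text \<open>
  Let \<open>a\<close> be the sum of the points of the configuration.  Moving the points along lines gives a curve
  through \<open>a\<close> in the cone over the secant variety, and its direction is an arbitrary sum of tangent
  vectors, hence an arbitrary vector.  A homogeneous polynomial that vanishes on the secants thus vanishes
  everywhere.  The configuration is enumerated by \<open>l < s\<close>, repeating one point if necessary.
\<close>

lemma secant_variety_eq_proj_space: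
  assumes P: "spanning_configuration m n P" "P \<noteq> {}" "finite P" "card P \<le> s"
    and nz: "\<And>x y. (x, y) \<in> P \<Longrightarrow> x \<in> coord_space {..m} - {0} \<and> y \<in> coord_space {..n} - {0}"
  shows "secant_variety (sv_index m n) (segre_veronese m n) s = proj_space (sv_index m n)"
proof -
  let ?I = "sv_index m n"
  let ?S = "\<Union>p\<in>{..<s} \<rightarrow> segre_veronese m n. proj_span ?I (p ` {..<s})"
  obtain h where h: "bij_betw h {0..<card P} P"
    using ex_bij_betw_nat_finite[OF P(3)] by blast
  have cP: "card P > 0" using P by (simp add: card_gt_0_iff)
  define h' where "h' l = h (if l < card P then l else 0)" for l
  have "h' ` {..<s} = P"
  proof -
    have "h' ` {..<s} = h ` {0..<card P}"
      using cP P(4) by (force simp: h'_def image_iff)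
    then show ?thesis using h by (simp add: bij_betw_def)
  qed
  define X Y where "X = fst \<circ> h'" and "Y = snd \<circ> h'"
  have XY_P: "(\<lambda>l. (X l, Y l)) ` {..<s} = P"
    using \<open>h' ` {..<s} = P\<close> by (simp add: X_def Y_def)
  have XY: "X l \<in> coord_space {..m} - {0}" "Y l \<in> coord_space {..n} - {0}" if "l < s" for l
    using nz XY_P that by blast+
  have s: "0 < s" using cP P(4) by simp
  define a where "a = (\<lambda>idx. \<Sum>l<s. sv_map (X l) (Y l) idx)"
  have a: "a \<in> coord_space ?I"
  proof -
    have "sv_map (X l) (Y l) \<in> coord_space ?I" if "l < s" for l
      using XY[OF that] by (intro sv_map_in_coord_space) auto
    then show ?thesis by (auto simp: a_def coord_space_def)
  qed
  have vanish: "eval_poly p v = 0"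
    if F: "F \<subseteq> homogeneous_polys ?I" "?S \<subseteq> zero_locus ?I F" and p: "p \<in> F"
      and v: "v \<in> coord_space ?I" for F p v
  proof (rule polyfun_vanishes_of_curves[OF eval_poly_in_polyfuns a _ v])
    have p_hom: "p \<in> homogeneous_polys ?I" using F(1) p by blast
    have on_S: "eval_poly p u = 0" if "proj_point u \<in> ?S" for u
      using F that p proj_point_in_zero_locus_iff[OF F(1)] by blast
    \<comment> \<open>The curve may pass through the origin, where \<open>p\<close> vanishes because \<open>p\<close> is homogeneous and has a zero.\<close>
    have p0: "eval_poly p 0 = 0"
    proof -
      let ?v = "sv_map (X 0) (Y 0)"
      define q where "q = (\<lambda>l :: nat. proj_point ?v)"
      have q: "proj_point ?v \<in> segre_veronese m n"
        using XY[OF s] unfolding segre_veronese_def by blast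
      have "?v \<in> \<Union> (q ` {..<s})" using proj_point_self s by (auto simp: q_def)
      then have "proj_point ?v \<subseteq> cspan (\<Union> (q ` {..<s}))"
        unfolding proj_point_def by (intro cfun.span_minimal cfun.subspace_span) (auto intro: cfun.span_base)
      then have "proj_point ?v \<in> proj_span ?I (q ` {..<s})"
        using q segre_veronese_subset by (auto simp: proj_span_def)
      moreover have "q \<in> {..<s} \<rightarrow> segre_veronese m n" using q by (simp add: q_def)
      ultimately have "eval_poly p ?v = 0" by (intro on_S) blast
      moreover obtain d where "\<forall>c v. eval_poly p (\<lambda>i. c * v i) = c ^ d * eval_poly p v"
        using homogeneous_eval_scale[OF p_hom] by blast
      ultimately have "eval_poly p (\<lambda>i. 0 * ?v i) = 0" by (simp only: mult_zero_right)
      then show ?thesis by (simp add: zero_fun_def)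
    qed
    fix w assume w: "w \<in> coord_space ?I"
    obtain A B where AB: "\<And>l. A l \<in> coord_space {..m}" "\<And>l. B l \<in> coord_space {..n}"
      "w = (\<lambda>idx. \<Sum>l<s. sv_tangent (X l) (Y l) (A l) (B l) idx)"
      using tangents_span[of m n X Y s w] P(1) XY w unfolding XY_P by blast
    \<comment> \<open>All but finitely many \<open>t\<close> keep the moved vectors away from \<open>0\<close>.\<close>
    define E where "E = {t. \<forall>l<s. (\<lambda>i. X l i + t * A l i) \<noteq> 0 \<and> (\<lambda>j. Y l j + t * B l j) \<noteq> 0}"
    have "- E = (\<Union>l<s. {t. (\<lambda>i. X l i + t * A l i) = 0} \<union> {t. (\<lambda>j. Y l j + t * B l j) = 0})"
      by (auto simp: E_def)
    moreover have "finite \<dots>"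
      using XY by (intro finite_UN_I finite_UnI cofinite_line_nonzero) auto
    ultimately have "finite (- E)" by simp
    then have "infinite E"
      using infinite_UNIV_char_0[where 'a = complex] by (metis Compl_partition finite_Un)
    define C where "C idx = [:w idx, \<Sum>l<s. sv_second (X l) (Y l) (A l) (B l) idx, \<Sum>l<s. sv_map (A l) (B l) idx:]" for idx
    have curve: "a idx + t * poly (C idx) t =
        (\<Sum>l<s. sv_map (\<lambda>i. X l i + t * A l i) (\<lambda>j. Y l j + t * B l j) idx)" for t idx
      unfolding sv_map_expand C_def AB(3) a_def
      by (simp add: sum.distrib sum_distrib_left algebra_simps)
    have "eval_poly p (\<lambda>idx. a idx + t * poly (C idx) t) = 0" if t: "t \<in> E" for t
    proof (cases "(\<lambda>idx. a idx + t * poly (C idx) t) = 0")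
      case True
      then show ?thesis using p0 by simp
    next
      case False
      have "(\<lambda>i. X l i + t * A l i) \<in> coord_space {..m} - {0}"
        "(\<lambda>j. Y l j + t * B l j) \<in> coord_space {..n} - {0}" if "l < s" for l
        using XY[OF that] AB(1,2)[of l] t that by (auto simp: E_def coord_space_def)
      then show ?thesis
        using False by (intro on_S secant_point[where x = "\<lambda>l i. X l i + t * A l i" and y = "\<lambda>l j. Y l j + t * B l j"])
          (auto simp: curve)
    qed
    moreover have "(\<lambda>idx. poly (C idx) t) \<in> coord_space ?I" for t
    proof -
      have "sv_second (X l) (Y l) (A l) (B l) \<in> coord_space ?I" "sv_map (A l) (B l) \<in> coord_space ?I"
        if "l < s" for l
        using XY[OF that] AB(1,2) by (auto intro!: sv_tangent_in_coord_space sv_map_in_coord_space)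
      then show ?thesis using w by (auto simp: coord_space_def C_def)
    qed
    moreover have "\<forall>idx. poly (C idx) 0 = w idx" by (simp add: C_def)
    ultimately show "\<exists>P E. infinite E \<and> (\<forall>i. poly (P i) 0 = w i) \<and>
        (\<forall>t. (\<lambda>i. poly (P i) t) \<in> coord_space ?I) \<and>
        (\<forall>t\<in>E. eval_poly p (\<lambda>i. a i + t * poly (P i) t) = 0)"
      using \<open>infinite E\<close> by blast
  qed
  have S_sub: "?S \<subseteq> topspace (zariski ?I)" by (auto simp: proj_span_def)
  obtain F where F: "F \<subseteq> homogeneous_polys ?I" "zariski ?I closure_of ?S = zero_locus ?I F"
    using closedin_closure_of[of "zariski ?I" ?S] unfolding closedin_zariski by blast
  have "?S \<subseteq> zero_locus ?I F"
    using closure_of_subset[OF S_sub] F(2) by simp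
  then have "proj_point v \<in> zero_locus ?I F" if "v \<in> coord_space ?I - {0}" for v
    using vanish[OF F(1)] that unfolding proj_point_in_zero_locus_iff[OF F(1)] by blast
  then have "zero_locus ?I F = proj_space ?I"
    by (auto simp: proj_space_def zero_locus_def)
  then show ?thesis unfolding secant_variety_def F(2) .
qed

section \<open>The expected dimension\<close>

text \<open>
  With \<open>k = n div 2\<close> and \<open>q = m - 1\<close>, the difference of the two sides at \<open>s = s_bar m n\<close> is
  \<open>k (q\<^sup>2 + q)\<close> for even \<open>n\<close> and \<open>k (q\<^sup>2 + 2) + 3\<close> for odd \<open>n\<close>.
\<close>

lemma card_sv_index_le:
  assumes "m \<ge> 1" "s \<ge> s_bar m n"
  shows "card (sv_index m n) \<le> s * (m + n + 1)"
proof -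
  obtain q where q: "m = Suc q" using assms(1) by (cases m) auto
  have "card (sv_index m n) \<le> s_bar m n * (m + n + 1)"
  proof (cases "even n")
    case True
    then obtain k where k: "n = 2 * k" by (elim evenE)
    have "(n + 2) choose 2 = (k + 1) * (2 * k + 1)"
      unfolding k choose_two by (simp add: algebra_simps)
    then have "card (sv_index m n) + k * (q * q + q) = s_bar m n * (m + n + 1)"
      unfolding card_sv_index by (simp add: s_bar_def q k algebra_simps)
    then show ?thesis by linarith
  next
    case False
    then obtain k where k: "n = 2 * k + 1" by (elim oddE)
    have "(n + 2) choose 2 = (2 * k + 3) * (k + 1)"
      unfolding k choose_two by (simp add: algebra_simps)
    then have "card (sv_index m n) + (k * (q * q + 2) + 3) = s_bar m n * (m + n + 1)"
      unfolding card_sv_index by (simp add: s_bar_def q k algebra_simps)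
    then show ?thesis by linarith
  qed
  also have "\<dots> \<le> s * (m + n + 1)" using assms(2) by (intro mult_right_mono) auto
  finally show ?thesis .
qed

theorem theorem1p3:
  fixes m n s :: nat
  assumes "m \<ge> 1" and "s \<ge> s_bar m n"
  shows "secant_has_expected_dim (sv_index m n) (segre_veronese m n) s"
proof -
  let ?I = "sv_index m n" and ?X = "segre_veronese m n"
  have I: "finite ?I" "?I \<noteq> {}"
    by (rule finite_subset[of _ "{..m} \<times> {..n} \<times> {..n}"]) (auto simp: sv_index_def)
  obtain P where "P \<noteq> {}" "finite P" "card P \<le> s" "spanning_configuration m n P"
    "\<forall>(x, y)\<in>P. x \<in> coord_space {..m} - {0} \<and> y \<in> coord_space {..n} - {0}"
    using ex_spanning_configuration[OF assms] by blast
  then have "secant_variety ?I ?X s = proj_space ?I"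
    by (intro secant_variety_eq_proj_space) auto
  then have "variety_dim ?I (secant_variety ?I ?X s) = enat (card ?I - 1)"
    using krull_dim_proj_space_le[OF I] krull_dim_proj_space_ge[OF I]
    by (simp add: variety_dim_def subtopology_zariski_proj_space)
  moreover have "enat (card ?I - 1) \<le> enat s * (variety_dim ?I ?X + 1) - 1"
  proof (cases "variety_dim ?I ?X")
    case (enat d)
    then have "m + n \<le> d" using variety_dim_segre_veronese_ge[of m n] by simp
    then have "s * (m + n + 1) \<le> s * (d + 1)" by simp
    then have "card ?I - 1 \<le> s * (d + 1) - 1" using card_sv_index_le[OF assms] by linarith
    then show ?thesis by (simp add: enat one_enat_def)
  next
    case infinity
    have "s > 0" using assms(2) by (auto simp: s_bar_def split: if_splits)
    then show ?thesis by (simp add: infinity one_enat_def)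
  qed
  ultimately show ?thesis
    by (simp add: secant_has_expected_dim_def expected_secant_dim_def min_absorb1)
qed

end
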